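(* Let $p\geq2$, $n_1,\dots,n_l\geq1$ be integers with $\sum_j p^{-n_j}=1$ and let $T_p$ be the map satisfying Condition 1 with slopes $\Lambda_j=p^{n_j}$. Let $U_\Bbbk$, $\Bbbk=0,1,\dots$, be a sequence of unitary quantizations of $T_p$ (with respect to the partitions of $[0,1]$ into $N_\Bbbk=p^\Bbbk$ equal intervals), and let $(\psi_\Bbbk)$ be a sequence of normalized eigenvectors of the $U_\Bbbk$. Then the corresponding limiting invariant (semiclassical) measure $\mu=\lim_{\Bbbk\to\infty}\mu_\Bbbk$ satisfies $$H_{\mathrm{KS}}(T_p,\mu)\geq\sum_j\mu(I_j)\log\Lambda_j-\frac12\log\Lambda_{\max},\qquad\Lambda_{\max}=\max_j\Lambda_j.$$
   Context: Condition 1: $[0,1]$ is divided into consecutive intervals $I_1,\dots,I_l$ with $|I_j|=\Lambda_j^{-1}$ and $T_p$ is affine with slope $\Lambda_j$ on $I_j$ mapping $I_j$ onto $[0,1]$. Let $E_i=[(i-1)/N_\Bbbk,i/N_\Bbbk]$ and $B_\Bbbk(i,j)=|E_i\cap T_p^{-1}E_j|/|E_i|$; a quantization is a unitary $N_\Bbbk\times N_\Bbbk$ matrix $U_\Bbbk$ with $B_\Bbbk(j,i)=|U_\Bbbk(i,j)|^2$ for all $i,j$. $\mathrm{Op}_\Bbbk(f)$ is the diagonal matrix with $(i,i)$ entry $N_\Bbbk\int_{E_i}f\,dx$, and $\mu_\Bbbk$ is the probability measure with $\int f\,d\mu_\Bbbk=\langle\psi_\Bbbk,\mathrm{Op}_\Bbbk(f)\psi_\Bbbk\rangle$;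 $\mu$ is a weak-* limit of the $\mu_\Bbbk$. $H_{\mathrm{KS}}$ is Kolmogorov–Sinai entropy. *)

theory Defs
  imports "HOL-Probability.Probability"
begin

(* Slopes Lambda_j = p^(n_j), j = 0..l-1 (0-based indices). *)
definition Lam :: "nat \<Rightarrow> (nat \<Rightarrow> nat) \<Rightarrow> nat \<Rightarrow> real" where
  "Lam p n j = real p ^ n j"

definition lend :: "nat \<Rightarrow> (nat \<Rightarrow> nat) \<Rightarrow> nat \<Rightarrow> real" where
  "lend p n j = (\<Sum>i<j. 1 / Lam p n i)"

definition Iv :: "nat \<Rightarrow> nat \<Rightarrow> (nat \<Rightarrow> nat) \<Rightarrow> nat \<Rightarrow> real set" where
  "Iv p l n j = (if Suc j = l then {lend p n j .. 1} else {lend p n j ..< lend p n (Suc j)})"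

definition Tp :: "nat \<Rightarrow> nat \<Rightarrow> (nat \<Rightarrow> nat) \<Rightarrow> real \<Rightarrow> real" where
  "Tp p l n x = (\<Sum>j<l. indicator (Iv p l n j) x * (Lam p n j * (x - lend p n j)))"

definition Ecell :: "nat \<Rightarrow> nat \<Rightarrow> real set" where
  "Ecell N i = {real i / real N .. real (Suc i) / real N}"

definition Bmat :: "(real \<Rightarrow> real) \<Rightarrow> nat \<Rightarrow> nat \<Rightarrow> nat \<Rightarrow> real" where
  "Bmat T N i j = measure lborel {x \<in> Ecell N i. T x \<in> Ecell N j} / measure lborel (Ecell N i)"

definition quantization :: "(real \<Rightarrow> real) \<Rightarrow> nat \<Rightarrow> (nat \<Rightarrow> nat \<Rightarrow> complex) \<Rightarrow> bool" where
  "quantization T N U \<longleftrightarrow>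
     (\<forall>i<N. \<forall>j<N. (\<Sum>m<N. cnj (U m i) * U m j) = (if i = j then 1 else 0)) \<and>
     (\<forall>i<N. \<forall>j<N. Bmat T N j i = (cmod (U i j))\<^sup>2)"

definition normalized_eigenvector :: "nat \<Rightarrow> (nat \<Rightarrow> nat \<Rightarrow> complex) \<Rightarrow> (nat \<Rightarrow> complex) \<Rightarrow> bool" where
  "normalized_eigenvector N U \<psi> \<longleftrightarrow>
     (\<Sum>i<N. (cmod (\<psi> i))\<^sup>2) = 1 \<and> (\<exists>c. \<forall>i<N. (\<Sum>j<N. U i j * \<psi> j) = c * \<psi> i)"

(* mu_N: int f dmu = <psi, Op(f) psi> = sum_i |psi_i|^2 N int_{E_i} f dx *)
definition semiclassical_measure :: "nat \<Rightarrow> (nat \<Rightarrow> complex) \<Rightarrow> real measure" where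
  "semiclassical_measure N \<psi> =
     density lborel (\<lambda>x. ennreal (\<Sum>i<N. (cmod (\<psi> i))\<^sup>2 * real N * indicator (Ecell N i) x))"

definition is_partition :: "real set set \<Rightarrow> bool" where
  "is_partition P \<longleftrightarrow> finite P \<and> (\<forall>A\<in>P. A \<in> sets borel \<and> A \<subseteq> {0..1}) \<and>
     disjoint P \<and> \<Union>P = {0..1}"

definition part_entropy :: "real measure \<Rightarrow> real set set \<Rightarrow> real" where
  "part_entropy \<mu> P = - (\<Sum>A\<in>P. measure \<mu> A * ln (measure \<mu> A))"

definition join_part :: "(real \<Rightarrow> real) \<Rightarrow> real set set \<Rightarrow> nat \<Rightarrow> real set set" where
  "join_part T P m = {{0..1} \<inter> (\<Inter>i<m. (T ^^ i) -` A i) | A. \<forall>i<m. A i \<in> P}"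

(* entropy of T w.r.t. partition P: lim (1/m) H(P^m); taken as liminf (= the limit for
   invariant measures) *)
definition ent_part :: "(real \<Rightarrow> real) \<Rightarrow> real measure \<Rightarrow> real set set \<Rightarrow> ereal" where
  "ent_part T \<mu> P = liminf (\<lambda>m. ereal (part_entropy \<mu> (join_part T P (Suc m)) / real (Suc m)))"

definition KS_entropy :: "(real \<Rightarrow> real) \<Rightarrow> real measure \<Rightarrow> ereal" where
  "KS_entropy T \<mu> = (SUP P \<in> {P. is_partition P}. ent_part T \<mu> P)"

end

theory Submission
  imports Defs "HOL-Complex_Analysis.Conformal_Mappings"
begin

text \<open>Cut \<open>[0,1]\<close> into the cylinders of \<open>T\<^sub>p\<close> of length \<open>T = k div max n\<^sub>j\<close>; they are unions of
  the \<open>N = p^k\<close> cells. Write \<open>\<Lambda>(e)\<close> for the product of slopes along a word \<open>e\<close> and \<open>q(e)\<close> for the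
  weight that the eigenvector gives to the cylinder of \<open>e\<close>. Each row of \<open>U^T\<close> has at most one nonzero
  entry in the columns of this cylinder, with squared modulus at most \<open>1/\<Lambda>(e)\<close>, and the cylinder has at
  most \<open>N/\<Lambda>(e)\<close> cells; so the block of \<open>U^T\<close> between the cylinders of \<open>e\<close> and \<open>f\<close> has norm at most
  \<open>sqrt (N/(\<Lambda>(e) \<Lambda>(f)))\<close>. The three lines theorem turns this into the weighted entropic uncertainty
  principle \<open>- \<Sum> q(e) ln q(e) \<ge> \<Sum> q(e) ln \<Lambda>(e) - (ln N)/2\<close>. The weights are exactly stationary, because
  \<open>U\<close> carries cells to their images; hence the sum on the right is additive in \<open>T\<close>, and subadditivity
  of the entropy transfers the bound from length \<open>T\<close> to any fixed length \<open>m\<close>, up to \<open>O(1/T)\<close>. It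
  survives the limit since cylinder end points other than \<open>0\<close> and \<open>1\<close> carry no limit mass:
  stationarity makes a passage into a long run of the first or of the last symbol unlikely.\<close>

section \<open>The three lines theorem for exponential sums\<close>

text \<open>The factor \<open>exp (- z * L)\<close> with \<open>L = ln K\<close> brings the bound on
  both edges of the strip down to 1, and a Gaussian factor forces decay in the imaginary direction.
  The maximum modulus principle on a tall rectangle bounds the product by 1; then \<open>d\<close>
  tends to 0.\<close>

lemma three_lines_exp_sum:
  fixes g :: "'s \<Rightarrow> complex" and x :: "'s \<Rightarrow> real" and K t :: real
  assumes S: "finite S" and K: "K > 0" and t: "0 < t" "t < 1"
    and F_def: "F = (\<lambda>z. \<Sum>s\<in>S. g s * exp (z * of_real (x s)))"
    and b0: "\<And>y. cmod (F (\<i> * of_real y)) \<le> 1"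
    and b1: "\<And>y. cmod (F (1 + \<i> * of_real y)) \<le> K"
  shows "cmod (F (of_real t)) \<le> K powr t"
proof -
  define L where "L = ln K"
  define C where "C = (\<Sum>s\<in>S. cmod (g s) * exp \<bar>x s\<bar>)"
  have C0: "C \<ge> 0" unfolding C_def by (intro sum_nonneg) auto
  have FC: "cmod (F z) \<le> C" if "0 \<le> Re z" "Re z \<le> 1" for z
  proof -
    have "cmod (F z) \<le> (\<Sum>s\<in>S. cmod (g s * exp (z * of_real (x s))))"
      unfolding F_def by (rule norm_sum)
    also have "\<dots> \<le> C" unfolding C_def
    proof (rule sum_mono)
      fix s assume "s \<in> S"
      have "Re z * x s \<le> Re z * \<bar>x s\<bar>"
        using that by (intro mult_left_mono) auto
      also have "\<dots> \<le> \<bar>x s\<bar>" using that by (intro mult_left_le_one_le) auto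
      finally have "Re z * x s \<le> \<bar>x s\<bar>" .
      thus "cmod (g s * exp (z * of_real (x s))) \<le> cmod (g s) * exp \<bar>x s\<bar>"
        by (simp add: norm_mult mult_left_mono)
    qed
    finally show ?thesis .
  qed
  have bd: "cmod (F (of_real t)) * exp (- t * L) * exp (d * (t\<^sup>2 - 1)) \<le> 1" if d: "d > 0" for d
  proof -
    \<comment> \<open>In the strip, \<open>Re (z^2 - 1)\<close> is at most minus the square of
      \<open>Im z\<close>, so the damping factor never exceeds 1.\<close>
    define G where "G = (\<lambda>z. F z * exp (- z * of_real L) * exp (of_real d * (z\<^sup>2 - 1)))"
    \<comment> \<open>Chosen so that \<open>d * R^2 >= (C + 1) * exp |L|\<close>; as
      \<open>x <= exp x\<close>, the damping on the horizontal sides then outweighs the crude bound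
      \<open>C * exp |L|\<close>.\<close>
    define R where "R = sqrt ((C + 1) * exp \<bar>L\<bar> / d) + 1"
    have nG: "cmod (G z) = cmod (F z) * exp (- Re z * L) * exp (d * ((Re z)\<^sup>2 - (Im z)\<^sup>2 - 1))" for z
      unfolding G_def by (simp add: norm_mult power2_eq_square)
    have R: "R \<ge> 1" "(C + 1) * exp \<bar>L\<bar> \<le> d * R\<^sup>2"
    proof -
      have q: "0 \<le> (C + 1) * exp \<bar>L\<bar> / d" using C0 d by auto
      thus "R \<ge> 1" unfolding R_def by auto
      have "(C + 1) * exp \<bar>L\<bar> / d \<le> R\<^sup>2" unfolding R_def using q
        by (simp add: power2_sum)
      thus "(C + 1) * exp \<bar>L\<bar> \<le> d * R\<^sup>2" using d by (simp add: field_simps)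
    qed
    let ?B = "cbox (Complex 0 (-R)) (Complex 1 R)"
    have hol: "G holomorphic_on A" for A
      unfolding G_def F_def by (intro holomorphic_intros)
    have "cmod (G (of_real t)) \<le> 1"
    proof (rule maximum_modulus_frontier[of G ?B])
      show "G holomorphic_on interior ?B" by (rule hol)
      show "continuous_on (closure ?B) G" by (rule holomorphic_on_imp_continuous_on[OF hol])
      show "bounded ?B" by (rule bounded_cbox)
      show "of_real t \<in> ?B" using t R by (auto simp: in_cbox_complex_iff)
      fix z assume "z \<in> frontier ?B"
      hence z: "z \<in> ?B" "z \<notin> box (Complex 0 (-R)) (Complex 1 R)" by (auto simp: frontier_cbox)
      hence z1: "0 \<le> Re z" "Re z \<le> 1" "-R \<le> Im z" "Im z \<le> R" by (auto simp: in_cbox_complex_iff)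
      from z z1 consider "Re z = 0" | "Re z = 1" | "\<bar>Im z\<bar> = R"
        by (force simp: in_box_complex_iff)
      thus "cmod (G z) \<le> 1"
      proof cases
        case 1
        hence "z = \<i> * of_real (Im z)" by (simp add: complex_eq_iff)
        hence "cmod (F z) \<le> 1" using b0[of "Im z"] by metis
        moreover have "exp (d * ((Re z)\<^sup>2 - (Im z)\<^sup>2 - 1)) \<le> 1" using 1 d
          by (simp add: mult_le_0_iff order_trans[OF _ zero_le_power2])
        ultimately show ?thesis unfolding nG using 1 by (simp add: mult_le_one)
      next
        case 2
        hence "z = 1 + \<i> * of_real (Im z)" by (simp add: complex_eq_iff)
        hence "cmod (F z) \<le> K" using b1[of "Im z"] by metis
        hence "cmod (F z) * exp (- Re z * L) \<le> 1" using 2 K by (simp add: L_def exp_minus field_simps)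
        moreover have "exp (d * ((Re z)\<^sup>2 - (Im z)\<^sup>2 - 1)) \<le> 1" using 2 d
          by (simp add: mult_le_0_iff order_trans[OF _ zero_le_power2])
        ultimately show ?thesis unfolding nG by (simp add: mult_le_one)
      next
        case 3
        have r: "(Re z)\<^sup>2 \<le> 1" using z1 by (simp add: power_le_one)
        have "(Im z)\<^sup>2 = R\<^sup>2" using 3 by (metis power2_abs)
        hence "d * ((Re z)\<^sup>2 - (Im z)\<^sup>2 - 1) \<le> - (d * R\<^sup>2)"
          using r d by (simp add: algebra_simps)
        hence e: "exp (d * ((Re z)\<^sup>2 - (Im z)\<^sup>2 - 1)) \<le> exp (- (d * R\<^sup>2))" by simp
        have "Re z * (-L) \<le> Re z * \<bar>L\<bar>" using z1 by (intro mult_left_mono) auto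
        also have "\<dots> \<le> \<bar>L\<bar>" using z1 by (intro mult_left_le_one_le) auto
        finally have e2: "exp (- Re z * L) \<le> exp \<bar>L\<bar>" by simp
        have "d * R\<^sup>2 \<le> exp (d * R\<^sup>2)" using exp_ge_add_one_self[of "d*R\<^sup>2"] by linarith
        hence e3: "(C + 1) * exp \<bar>L\<bar> \<le> exp (d * R\<^sup>2)" using R by linarith
        have "cmod (G z) \<le> C * exp \<bar>L\<bar> * exp (- (d * R\<^sup>2))"
          unfolding nG using FC[OF z1(1,2)] e e2 C0 by (intro mult_mono) auto
        also have "\<dots> \<le> (C + 1) * exp \<bar>L\<bar> * exp (- (d * R\<^sup>2))" by simp
        also have "\<dots> \<le> 1" using e3 by (simp add: exp_minus field_simps)
        finally show ?thesis .
      qed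
    qed
    thus ?thesis unfolding nG by simp
  qed
  have "((\<lambda>d. cmod (F (of_real t)) * exp (- t * L) * exp (d * (t\<^sup>2 - 1)))
      \<longlongrightarrow> cmod (F (of_real t)) * exp (- t * L) * exp (0 * (t\<^sup>2 - 1))) (at_right 0)"
    by (intro tendsto_intros)
  hence "cmod (F (of_real t)) * exp (- t * L) * exp (0 * (t\<^sup>2 - 1)) \<le> 1"
    using eventually_mono[OF eventually_at_right_less bd] by (rule tendsto_upperbound[OF _ _ trivial_limit_at_right_real])
  thus ?thesis using K by (simp add: L_def powr_def exp_minus field_simps)
qed

text \<open>\<open>Re (F t)\<close> and \<open>K powr t\<close> agree at \<open>t = 0\<close>, and
  the first stays below the second on the right of 0, so their derivatives at 0 are ordered. This
  turns an interpolated norm bound into an inequality between logarithms, that is, between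
  entropies.\<close>

lemma three_lines_derivative:
  fixes g :: "'s \<Rightarrow> complex" and x :: "'s \<Rightarrow> real" and K :: real
  assumes S: "finite S" and K: "K > 0"
    and F_def: "F = (\<lambda>z. \<Sum>s\<in>S. g s * exp (z * of_real (x s)))"
    and F0: "F 0 = 1"
    and b0: "\<And>y. cmod (F (\<i> * of_real y)) \<le> 1"
    and b1: "\<And>y. cmod (F (1 + \<i> * of_real y)) \<le> K"
  shows "Re (\<Sum>s\<in>S. g s * of_real (x s)) \<le> ln K"
proof -
  define h where "h = (\<lambda>t::real. (\<Sum>s\<in>S. Re (g s) * exp (t * x s)) - exp (t * ln K))"
  have hF: "h t = Re (F (of_real t)) - exp (t * ln K)" for t
    unfolding h_def F_def by (simp add: Re_exp exp_of_real flip: of_real_mult)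
  have "(h has_real_derivative (\<Sum>s\<in>S. Re (g s) * (exp (0 * x s) * x s)) - exp (0 * ln K) * ln K) (at 0)"
    unfolding h_def by (auto intro!: derivative_eq_intros sum.cong)
  hence "(h has_real_derivative (\<Sum>s\<in>S. Re (g s) * x s) - ln K) (at 0)" by simp
  hence "((\<lambda>t. (h t - h 0) / (t - 0)) \<longlongrightarrow> (\<Sum>s\<in>S. Re (g s) * x s) - ln K) (at 0)"
    unfolding has_field_derivative_iff by simp
  hence lim: "((\<lambda>t. h t / t) \<longlongrightarrow> (\<Sum>s\<in>S. Re (g s) * x s) - ln K) (at_right 0)"
    by (simp add: hF F0 filterlim_at_split)
  have "eventually (\<lambda>t. h t / t \<le> 0) (at_right (0::real))"
    unfolding eventually_at_right_field
  proof (intro exI[of _ 1] conjI allI impI)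
    fix t :: real assume t: "0 < t" "t < 1"
    have "Re (F (of_real t)) \<le> K powr t"
      using three_lines_exp_sum[OF S K t F_def b0 b1] complex_Re_le_cmod order_trans by blast
    thus "h t / t \<le> 0" using t K by (simp add: hF powr_def divide_nonpos_pos)
  qed simp
  hence "(\<Sum>s\<in>S. Re (g s) * x s) - ln K \<le> 0"
    using lim by (intro tendsto_upperbound) auto
  thus ?thesis by simp
qed

section \<open>Entropic uncertainty\<close>

text \<open>\<open>g e e'\<close> stands for matrix elements between pieces of an eigenvector. On
  the imaginary axis the exponentials are phases and \<open>F\<close> is bounded by 1; on
  \<open>Re z = 1\<close> the block bounds sum to \<open>K\<close>. The row and column sums make the
  derivative of \<open>F\<close> at 0 twice the sum of \<open>q e * a e\<close>, which is the
  left-hand side.\<close>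

lemma entropic_uncertainty_blocks:
  fixes g :: "'w \<Rightarrow> 'w \<Rightarrow> complex" and q lam :: "'w \<Rightarrow> real"
  assumes fin: "finite W" and K: "K > 0"
    and q: "\<And>e. e \<in> W \<Longrightarrow> q e > 0" and lam: "\<And>e. e \<in> W \<Longrightarrow> lam e > 0"
    and q1: "sum q W = 1"
    and row: "\<And>e. e \<in> W \<Longrightarrow> (\<Sum>e'\<in>W. g e e') = of_real (q e)"
    and col: "\<And>e'. e' \<in> W \<Longrightarrow> (\<Sum>e\<in>W. g e e') = of_real (q e')"
    and phase: "\<And>u. (\<And>e. cmod (u e) = 1) \<Longrightarrow> cmod (\<Sum>e\<in>W. \<Sum>e'\<in>W. u e * u e' * g e e') \<le> 1"
    and block: "\<And>e e'. e \<in> W \<Longrightarrow> e' \<in> W \<Longrightarrow>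
      cmod (g e e') \<le> K * sqrt (q e * q e') / sqrt (lam e * lam e')"
  shows "(\<Sum>e\<in>W. q e * ln (q e)) + (\<Sum>e\<in>W. q e * ln (lam e)) \<le> ln K"
proof -
  \<comment> \<open>At \<open>Re z = 1\<close> the factors
    \<open>exp (a e) = sqrt (q e * lam e)\<close> cancel the denominator in \<open>block\<close> and
    complete \<open>sqrt (q e * q e')\<close> to \<open>q e * q e'\<close>, whose double sum is
    1.\<close>
  define a where "a = (\<lambda>e. ln (q e * lam e) / 2)"
  define F where "F = (\<lambda>z. \<Sum>s\<in>W\<times>W. g (fst s) (snd s) * exp (z * of_real (a (fst s) + a (snd s))))"
  have F: "F z = (\<Sum>e\<in>W. \<Sum>e'\<in>W. exp (z * of_real (a e)) * exp (z * of_real (a e')) * g e e')" for z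
    unfolding F_def by (simp add: sum.cartesian_product algebra_simps exp_add case_prod_beta)
  have ea: "exp (a e) = sqrt (q e * lam e)" if "e \<in> W" for e
    using q[OF that] lam[OF that] by (simp add: a_def exp_ln powr_half_sqrt[symmetric] powr_def)
  have "Re (\<Sum>s\<in>W\<times>W. g (fst s) (snd s) * of_real (a (fst s) + a (snd s))) \<le> ln K"
  proof (rule three_lines_derivative[OF _ K F_def])
    show "finite (W \<times> W)" using fin by simp
    show "F 0 = 1" using q1 by (simp add: F row flip: of_real_sum)
    fix y :: real
    show "cmod (F (\<i> * of_real y)) \<le> 1" unfolding F by (rule phase) simp
    show "cmod (F (1 + \<i> * of_real y)) \<le> K"
    proof -
      have "cmod (F (1 + \<i> * of_real y)) \<le>
        (\<Sum>e\<in>W. \<Sum>e'\<in>W. cmod (exp ((1 + \<i> * of_real y) * of_real (a e)) * exp ((1 + \<i> * of_real y) * of_real (a e')) * g e e'))"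
        unfolding F by (intro order_trans[OF norm_sum] sum_mono order_refl)
      also have "\<dots> \<le> (\<Sum>e\<in>W. \<Sum>e'\<in>W. K * (q e * q e'))"
      proof (intro sum_mono)
        fix e e' assume e: "e \<in> W" "e' \<in> W"
        note pos = q[OF e(1)] q[OF e(2)] lam[OF e(1)] lam[OF e(2)]
        have "cmod (exp ((1 + \<i> * of_real y) * of_real (a e)) * exp ((1 + \<i> * of_real y) * of_real (a e')) * g e e')
          = sqrt (q e * lam e) * sqrt (q e' * lam e') * cmod (g e e')"
          using e by (simp add: norm_mult ea)
        also have "\<dots> \<le> sqrt (q e * lam e) * sqrt (q e' * lam e') * (K * sqrt (q e * q e') / sqrt (lam e * lam e'))"
          using pos by (intro mult_left_mono block e) auto
        also have "\<dots> = K * (sqrt (q e) * sqrt (q e)) * (sqrt (q e') * sqrt (q e'))"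
          using pos by (simp add: real_sqrt_mult field_simps)
        also have "\<dots> = K * (q e * q e')" using pos by simp
        finally show "cmod (exp ((1 + \<i> * of_real y) * of_real (a e)) * exp ((1 + \<i> * of_real y) * of_real (a e')) * g e e')
          \<le> K * (q e * q e')" .
      qed
      also have "\<dots> = K" using q1 by (simp flip: sum_distrib_left)
      finally show ?thesis .
    qed
  qed
  moreover have "(\<Sum>s\<in>W\<times>W. g (fst s) (snd s) * of_real (a (fst s) + a (snd s))) =
     of_real ((\<Sum>e\<in>W. q e * a e) + (\<Sum>e\<in>W. q e * a e))"
  proof -
    have "(\<Sum>s\<in>W\<times>W. g (fst s) (snd s) * of_real (a (fst s) + a (snd s))) =
      (\<Sum>e\<in>W. \<Sum>e'\<in>W. g e e' * of_real (a e)) + (\<Sum>e\<in>W. \<Sum>e'\<in>W. g e e' * of_real (a e'))"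
      by (simp add: sum.cartesian_product case_prod_beta distrib_left sum.distrib)
    also have "(\<Sum>e\<in>W. \<Sum>e'\<in>W. g e e' * of_real (a e')) = (\<Sum>e'\<in>W. \<Sum>e\<in>W. g e e' * of_real (a e'))"
      by (rule sum.swap)
    finally show ?thesis by (simp add: row col flip: sum_distrib_right)
  qed
  ultimately have "(\<Sum>e\<in>W. q e * a e) + (\<Sum>e\<in>W. q e * a e) \<le> ln K" by (simp only: complex.sel Re_complex_of_real)
  moreover have "q e * a e + q e * a e = q e * ln (q e) + q e * ln (lam e)" if "e \<in> W" for e
    using q[OF that] lam[OF that] by (simp add: a_def ln_mult algebra_simps)
  ultimately show ?thesis by (simp flip: sum.distrib)
qed

section \<open>Norm estimates for finite complex sums and matrices\<close>

lemma cmod_sum_single_square: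
  fixes f :: "'a \<Rightarrow> complex"
  assumes "finite A" "\<And>j j'. j \<in> A \<Longrightarrow> j' \<in> A \<Longrightarrow> f j \<noteq> 0 \<Longrightarrow> f j' \<noteq> 0 \<Longrightarrow> j = j'"
  shows "(cmod (sum f A))\<^sup>2 = (\<Sum>j\<in>A. (cmod (f j))\<^sup>2)"
proof (cases "\<exists>j\<in>A. f j \<noteq> 0")
  case True
  then obtain j where j: "j \<in> A" "f j \<noteq> 0" by blast
  have "sum f A = sum f {j}"
    using assms j by (intro sum.mono_neutral_right) auto
  moreover have "(\<Sum>j\<in>A. (cmod (f j))\<^sup>2) = (\<Sum>j\<in>{j}. (cmod (f j))\<^sup>2)"
    using assms j by (intro sum.mono_neutral_right) auto
  ultimately show ?thesis by simp
qed simp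

lemma cmod_sum_le_L2:
  fixes f h :: "'a \<Rightarrow> complex"
  shows "cmod (\<Sum>i\<in>A. cnj (f i) * h i) \<le> sqrt (\<Sum>i\<in>A. (cmod (f i))\<^sup>2) * sqrt (\<Sum>i\<in>A. (cmod (h i))\<^sup>2)"
proof -
  have "cmod (\<Sum>i\<in>A. cnj (f i) * h i) \<le> (\<Sum>i\<in>A. \<bar>cmod (f i)\<bar> * \<bar>cmod (h i)\<bar>)"
    by (rule order_trans[OF norm_sum]) (simp add: norm_mult)
  also have "\<dots> \<le> L2_set (\<lambda>i. cmod (f i)) A * L2_set (\<lambda>i. cmod (h i)) A" by (rule L2_set_mult_ineq)
  finally show ?thesis by (simp add: L2_set_def)
qed

lemma orthonormal_columns_isometry:
  fixes V :: "'i \<Rightarrow> 'i \<Rightarrow> complex"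
  assumes fin: "finite I"
    and orth: "\<And>j j'. j \<in> I \<Longrightarrow> j' \<in> I \<Longrightarrow> (\<Sum>i\<in>I. cnj (V i j) * V i j') = (if j = j' then 1 else 0)"
  shows "(\<Sum>i\<in>I. (cmod (\<Sum>j\<in>I. V i j * v j))\<^sup>2) = (\<Sum>j\<in>I. (cmod (v j))\<^sup>2)"
proof -
  have "complex_of_real (\<Sum>i\<in>I. (cmod (\<Sum>j\<in>I. V i j * v j))\<^sup>2) =
    (\<Sum>i\<in>I. (\<Sum>j\<in>I. \<Sum>j'\<in>I. cnj (v j) * v j' * (cnj (V i j) * V i j')))"
    by (simp only: of_real_sum complex_norm_square cnj_sum sum_product complex_cnj_mult)
      (rule sum.cong[OF refl], subst sum.swap, simp add: mult_ac)
  also have "\<dots> = (\<Sum>j\<in>I. \<Sum>j'\<in>I. \<Sum>i\<in>I. cnj (v j) * v j' * (cnj (V i j) * V i j'))"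
    by (subst sum.swap, rule sum.cong[OF refl], rule sum.swap)
  also have "\<dots> = (\<Sum>j\<in>I. \<Sum>j'\<in>I. cnj (v j) * v j' * (if j = j' then 1 else 0))"
    by (simp add: orth flip: sum_distrib_left)
  also have "\<dots> = complex_of_real (\<Sum>j\<in>I. (cmod (v j))\<^sup>2)"
    using fin by (simp add: complex_norm_square mult_ac if_distrib del: of_real_power cong: if_cong)
  finally show ?thesis by (simp only: of_real_eq_iff)
qed

text \<open>Cut the index set into the classes of \<open>w\<close>. At most one nonzero entry per
  row and class excludes cross terms when \<open>V\<close> acts on a piece of \<open>\<psi>\<close>;
  with a bound on the class sizes and Cauchy-Schwarz this gives the block bound for
  \<open>K = sqrt N\<close>. The eigenvector equation and its adjoint supply the column and row
  sums.\<close>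

lemma entropic_uncertainty:
  fixes V :: "'i \<Rightarrow> 'i \<Rightarrow> complex" and \<psi> :: "'i \<Rightarrow> complex" and w :: "'i \<Rightarrow> 'w"
  assumes fin: "finite I"
    and orth: "\<And>j j'. j \<in> I \<Longrightarrow> j' \<in> I \<Longrightarrow> (\<Sum>i\<in>I. cnj (V i j) * V i j') = (if j = j' then 1 else 0)"
    and norm1: "(\<Sum>i\<in>I. (cmod (\<psi> i))\<^sup>2) = 1"
    and eig: "\<And>i. i \<in> I \<Longrightarrow> (\<Sum>j\<in>I. V i j * \<psi> j) = c * \<psi> i"
    and lam: "\<And>e. lam e > 0"
    and bound: "\<And>i j. i \<in> I \<Longrightarrow> j \<in> I \<Longrightarrow> (cmod (V i j))\<^sup>2 \<le> 1 / lam (w j)"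
    and uniq: "\<And>i j j'. i \<in> I \<Longrightarrow> j \<in> I \<Longrightarrow> j' \<in> I \<Longrightarrow> w j = w j' \<Longrightarrow> V i j \<noteq> 0 \<Longrightarrow> V i j' \<noteq> 0 \<Longrightarrow> j = j'"
    and q_def: "q = (\<lambda>e. \<Sum>i\<in>{i\<in>I. w i = e}. (cmod (\<psi> i))\<^sup>2)"
  shows "(\<Sum>e\<in>w ` I. q e * ln (q e)) + (\<Sum>e\<in>w ` I. q e * ln (lam e)) \<le> ln (real (card I)) / 2"
proof -
  define A where "A = (\<lambda>e. {i\<in>I. w i = e})"
  have finA: "finite (A e)" for e using fin by (simp add: A_def)
  have AI: "A e \<subseteq> I" for e by (auto simp: A_def)
  define N where "N = real (card I)"
  have "I \<noteq> {}" using norm1 by auto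
  hence N: "N > 0" using fin by (simp add: N_def card_gt_0_iff)
  note iso = orthonormal_columns_isometry[OF fin orth]
  have c1: "cmod c = 1"
  proof -
    have "(\<Sum>i\<in>I. (cmod (c * \<psi> i))\<^sup>2) = 1" using iso[of \<psi>] eig norm1 by simp
    hence "(cmod c)\<^sup>2 = 1" using norm1 by (simp add: norm_mult power_mult_distrib flip: sum_distrib_left)
    thus ?thesis using norm_ge_zero[of c] power2_eq_1_iff[of "cmod c"] by linarith
  qed
  have cc: "cnj c * c = 1" using complex_norm_square[of c] c1 by (simp add: mult.commute)
  have colnorm: "(\<Sum>i\<in>I. (cmod (V i j))\<^sup>2) = 1" if "j \<in> I" for j
  proof -
    have "complex_of_real (\<Sum>i\<in>I. (cmod (V i j))\<^sup>2) = 1"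
      using orth[OF that that] by (simp add: complex_norm_square mult.commute del: of_real_power)
    thus ?thesis by (simp only: of_real_eq_1_iff)
  qed
  have row: "(\<Sum>j\<in>A e. (cmod (V i j))\<^sup>2) \<le> 1 / lam e" if i: "i \<in> I" for i e
  proof (cases "\<exists>j\<in>A e. V i j \<noteq> 0")
    case True
    then obtain j where j: "j \<in> A e" "V i j \<noteq> 0" by blast
    have "(\<Sum>j\<in>A e. (cmod (V i j))\<^sup>2) = (\<Sum>j\<in>{j}. (cmod (V i j))\<^sup>2)"
      using j uniq[OF i] finA by (intro sum.mono_neutral_right) (auto simp: A_def)
    thus ?thesis using bound[OF i] j by (auto simp: A_def)
  next
    case False
    thus ?thesis using lam[of e] by (auto intro: order.strict_implies_order)
  qed
  \<comment> \<open>Double counting: each column has norm 1, while each of the \<open>N\<close> rows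
    contributes at most \<open>1 / lam e\<close> to the columns of class \<open>e\<close>.\<close>
  have cardA: "real (card (A e)) \<le> N / lam e" for e
  proof -
    have "real (card (A e)) = (\<Sum>j\<in>A e. \<Sum>i\<in>I. (cmod (V i j))\<^sup>2)"
      using AI by (simp add: colnorm subset_iff)
    also have "\<dots> = (\<Sum>i\<in>I. \<Sum>j\<in>A e. (cmod (V i j))\<^sup>2)" by (rule sum.swap)
    also have "\<dots> \<le> (\<Sum>i\<in>I. 1 / lam e)" by (intro sum_mono row)
    finally show ?thesis by (simp add: N_def)
  qed
  \<comment> \<open>The factor \<open>cnj c\<close> removes the eigenvalue, so that all blocks
    together sum to 1.\<close>
  define g where "g = (\<lambda>e e'. cnj c * (\<Sum>i\<in>A e'. cnj (\<psi> i) * (\<Sum>j\<in>A e. V i j * \<psi> j)))"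
  have q: "q e = (\<Sum>i\<in>A e. (cmod (\<psi> i))\<^sup>2)" for e by (simp add: q_def A_def)
  have q0: "q e \<ge> 0" for e unfolding q by (intro sum_nonneg) auto
  \<comment> \<open>Classes of weight 0 are dropped because the exponents involve
    \<open>ln (q e)\<close>; their blocks vanish by \<open>gb\<close>, so no sum changes.\<close>
  define W where "W = {e \<in> w ` I. q e > 0}"
  have finW: "finite W" using fin by (simp add: W_def)
  have inner: "(cmod (\<Sum>j\<in>A e. V i j * \<psi> j))\<^sup>2 \<le> q e / lam e" if i: "i \<in> I" for i e
  proof -
    have "(cmod (\<Sum>j\<in>A e. V i j * \<psi> j))\<^sup>2 = (\<Sum>j\<in>A e. (cmod (V i j * \<psi> j))\<^sup>2)"
      using uniq[OF i] by (intro cmod_sum_single_square finA) (auto simp: A_def)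
    also have "\<dots> \<le> (\<Sum>j\<in>A e. 1 / lam e * (cmod (\<psi> j))\<^sup>2)"
    proof (rule sum_mono)
      fix j assume "j \<in> A e"
      hence "(cmod (V i j))\<^sup>2 \<le> 1 / lam e" using bound[OF i] by (auto simp: A_def)
      thus "(cmod (V i j * \<psi> j))\<^sup>2 \<le> 1 / lam e * (cmod (\<psi> j))\<^sup>2"
        unfolding norm_mult power_mult_distrib by (rule mult_right_mono) simp
    qed
    also have "\<dots> = q e / lam e" by (simp add: q sum_divide_distrib)
    finally show ?thesis .
  qed
  have gb: "cmod (g e e') \<le> sqrt N * sqrt (q e * q e') / sqrt (lam e * lam e')" for e e'
  proof -
    have "cmod (g e e') = cmod (\<Sum>i\<in>A e'. cnj (\<psi> i) * (\<Sum>j\<in>A e. V i j * \<psi> j))"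
      using c1 by (simp add: g_def norm_mult)
    also have "\<dots> \<le> sqrt (q e') * sqrt (\<Sum>i\<in>A e'. (cmod (\<Sum>j\<in>A e. V i j * \<psi> j))\<^sup>2)"
      unfolding q by (rule cmod_sum_le_L2)
    also have "\<dots> \<le> sqrt (q e') * sqrt (N / lam e' * (q e / lam e))"
    proof (intro mult_left_mono real_sqrt_le_mono)
      have "(\<Sum>i\<in>A e'. (cmod (\<Sum>j\<in>A e. V i j * \<psi> j))\<^sup>2) \<le> (\<Sum>i\<in>A e'. q e / lam e)"
        using AI by (intro sum_mono inner) auto
      also have "\<dots> \<le> N / lam e' * (q e / lam e)"
        using cardA[of e'] q0[of e] lam[of e] by (simp only: sum_constant) (intro mult_right_mono, auto)
      finally show "(\<Sum>i\<in>A e'. (cmod (\<Sum>j\<in>A e. V i j * \<psi> j))\<^sup>2) \<le> N / lam e' * (q e / lam e)" .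
    qed (use q0 in auto)
    also have "\<dots> = sqrt N * sqrt (q e * q e') / sqrt (lam e * lam e')"
      by (simp add: real_sqrt_mult real_sqrt_divide mult_ac)
    finally show ?thesis .
  qed
  have neutral: "(\<Sum>e\<in>W. h e) = (\<Sum>i\<in>w ` I. h i)" if "\<And>e. q e = 0 \<Longrightarrow> h e = 0" for h :: "'w \<Rightarrow> 'b::comm_monoid_add"
  proof (rule sum.mono_neutral_left)
    show "\<forall>i\<in>w ` I - W. h i = 0"
      using that q0 by (force simp: W_def order.order_iff_strict)
  qed (use fin in \<open>auto simp: W_def\<close>)
  have g0: "g e e' = 0" if "q e = 0 \<or> q e' = 0" for e e'
  proof -
    have "cmod (g e e') \<le> 0" using gb[of e e'] that by auto
    thus ?thesis by simp
  qed
  have group: "(\<Sum>e\<in>w ` I. \<Sum>i\<in>A e. h i) = (\<Sum>i\<in>I. h i)" for h :: "'i \<Rightarrow> 'b::comm_monoid_add"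
    unfolding A_def by (rule sum.image_gen[OF fin, symmetric])
  have main: "(\<Sum>e\<in>W. q e * ln (q e)) + (\<Sum>e\<in>W. q e * ln (lam e)) \<le> ln (sqrt N)"
  proof (rule entropic_uncertainty_blocks[OF finW, where g = g])
    show "sqrt N > 0" using N by simp
    show "q e > 0" if "e \<in> W" for e using that by (simp add: W_def)
    show "lam e > 0" if "e \<in> W" for e by (rule lam)
    show "sum q W = 1" using neutral[of q] group[of "\<lambda>i. (cmod (\<psi> i))\<^sup>2"] norm1 by (simp add: q)
    show "cmod (g e e') \<le> sqrt N * sqrt (q e * q e') / sqrt (lam e * lam e')" for e e' by (rule gb)
    show "(\<Sum>e'\<in>W. g e e') = of_real (q e)" if "e \<in> W" for e
    proof -
      \<comment> \<open>\<open>\<psi>\<close> is also an eigenvector of the adjoint: pair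
        \<open>V \<psi> = c \<psi>\<close> with column \<open>j\<close> and use orthonormality of
        the columns.\<close>
      have adj: "cnj c * (\<Sum>i\<in>I. cnj (\<psi> i) * V i j) = cnj (\<psi> j)" if j: "j \<in> I" for j
      proof -
        have "cnj c * (\<Sum>i\<in>I. cnj (\<psi> i) * V i j) = (\<Sum>i\<in>I. cnj (c * \<psi> i) * V i j)"
          by (simp add: sum_distrib_left mult_ac)
        also have "\<dots> = (\<Sum>i\<in>I. (\<Sum>j'\<in>I. cnj (\<psi> j') * (cnj (V i j') * V i j)))"
          by (intro sum.cong refl, subst eig[symmetric]) (auto simp: sum_distrib_right sum_distrib_left mult_ac)
        also have "\<dots> = (\<Sum>j'\<in>I. cnj (\<psi> j') * (\<Sum>i\<in>I. cnj (V i j') * V i j))"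
          by (subst sum.swap) (simp add: sum_distrib_left)
        also have "\<dots> = cnj (\<psi> j)" using j fin by (simp add: orth if_distrib cong: if_cong)
        finally show ?thesis .
      qed
      have "(\<Sum>e'\<in>W. g e e') = (\<Sum>e'\<in>w ` I. g e e')" by (rule neutral) (simp add: g0)
      also have "\<dots> = cnj c * (\<Sum>i\<in>I. cnj (\<psi> i) * (\<Sum>j\<in>A e. V i j * \<psi> j))"
        unfolding g_def by (simp only: sum_distrib_left[symmetric] group)
      also have "\<dots> = (\<Sum>i\<in>I. \<Sum>j\<in>A e. \<psi> j * (cnj c * (cnj (\<psi> i) * V i j)))"
        by (simp add: sum_distrib_left mult_ac)
      also have "\<dots> = (\<Sum>j\<in>A e. \<psi> j * (cnj c * (\<Sum>i\<in>I. cnj (\<psi> i) * V i j)))"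
        by (subst sum.swap) (simp add: sum_distrib_left)
      also have "\<dots> = (\<Sum>j\<in>A e. \<psi> j * cnj (\<psi> j))" using AI[of e] by (intro sum.cong) (auto simp: adj subset_iff)
      finally show ?thesis by (simp add: q complex_norm_square del: of_real_power)
    qed
    show "(\<Sum>e\<in>W. g e e') = of_real (q e')" if "e' \<in> W" for e'
    proof -
      have "(\<Sum>e\<in>W. g e e') = (\<Sum>e\<in>w ` I. g e e')" by (rule neutral) (simp add: g0)
      also have "\<dots> = cnj c * (\<Sum>i\<in>A e'. cnj (\<psi> i) * (\<Sum>e\<in>w ` I. \<Sum>j\<in>A e. V i j * \<psi> j))"
        unfolding g_def by (simp add: sum_distrib_left[symmetric]) (subst sum.swap, simp add: sum_distrib_left)
      also have "\<dots> = cnj c * (\<Sum>i\<in>A e'. cnj (\<psi> i) * (c * \<psi> i))"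
        using AI eig by (intro arg_cong[where f = "\<lambda>x. cnj c * x"] sum.cong) (auto simp: group subset_iff)
      also have "\<dots> = (\<Sum>i\<in>A e'. (cnj c * c) * (\<psi> i * cnj (\<psi> i)))"
        by (simp add: sum_distrib_left mult_ac)
      finally show ?thesis by (simp add: cc q complex_norm_square del: of_real_power)
    qed
    fix u :: "'w \<Rightarrow> complex" assume u: "\<And>e. cmod (u e) = 1"
    \<comment> \<open>Phases constant on classes form a diagonal unitary matrix \<open>D\<close>.
      The double sum is \<open>cnj c\<close> times the inner product of the unit vectors
      \<open>cnj D \<psi>\<close> and \<open>V D \<psi>\<close>.\<close>
    have "(\<Sum>e\<in>W. \<Sum>e'\<in>W. u e * u e' * g e e') = (\<Sum>e\<in>w ` I. \<Sum>e'\<in>w ` I. u e * u e' * g e e')"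
      by (subst neutral; (subst neutral)?) (auto simp: g0)
    also have "\<dots> = cnj c * (\<Sum>e'\<in>w ` I. \<Sum>i\<in>A e'. u e' * cnj (\<psi> i) * (\<Sum>e\<in>w ` I. \<Sum>j\<in>A e. u e * (V i j * \<psi> j)))"
      unfolding g_def
      by (subst sum.swap) (simp add: sum_distrib_left sum_distrib_right mult_ac, intro sum.cong refl, subst sum.swap, simp)
    also have "\<dots> = cnj c * (\<Sum>e'\<in>w ` I. \<Sum>i\<in>A e'. u (w i) * cnj (\<psi> i) * (\<Sum>e\<in>w ` I. \<Sum>j\<in>A e. u (w j) * (V i j * \<psi> j)))"
      by (intro arg_cong[where f = "\<lambda>x. cnj c * x"] sum.cong arg_cong2[where f = "(*)"] refl) (auto simp: A_def)
    also have "\<dots> = cnj c * (\<Sum>i\<in>I. u (w i) * cnj (\<psi> i) * (\<Sum>j\<in>I. u (w j) * (V i j * \<psi> j)))"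
      by (simp only: group)
    also have "\<dots> = cnj c * (\<Sum>i\<in>I. cnj (cnj (u (w i)) * \<psi> i) * (\<Sum>j\<in>I. V i j * (u (w j) * \<psi> j)))"
      by (simp add: mult_ac)
    finally have "cmod (\<Sum>e\<in>W. \<Sum>e'\<in>W. u e * u e' * g e e') =
      cmod (\<Sum>i\<in>I. cnj (cnj (u (w i)) * \<psi> i) * (\<Sum>j\<in>I. V i j * (u (w j) * \<psi> j)))"
      using c1 by (simp only: norm_mult complex_mod_cnj mult_1)
    also have "\<dots> \<le> sqrt (\<Sum>i\<in>I. (cmod (cnj (u (w i)) * \<psi> i))\<^sup>2) * sqrt (\<Sum>i\<in>I. (cmod (\<Sum>j\<in>I. V i j * (u (w j) * \<psi> j)))\<^sup>2)"
      by (rule cmod_sum_le_L2)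
    also have "\<dots> = 1" by (simp add: iso norm_mult u norm1)
    finally show "cmod (\<Sum>e\<in>W. \<Sum>e'\<in>W. u e * u e' * g e e') \<le> 1" .
  qed
  show ?thesis using main N
    by (simp add: neutral ln_sqrt N_def)
qed

section \<open>Entropy of stationary words\<close>

text \<open>Gibbs' inequality: apply \<open>ln x <= x - 1\<close> to the quotient of the product of
  the marginals by the joint weight. The right-hand sides sum to 0 because both have total mass
  1.\<close>

lemma entropy_subadditive:
  fixes P :: "'a \<Rightarrow> 'b \<Rightarrow> real"
  assumes fin: "finite A" "finite B" and P0: "\<And>a b. a \<in> A \<Longrightarrow> b \<in> B \<Longrightarrow> P a b \<ge> 0"
    and P1: "\<And>a. a \<in> A \<Longrightarrow> (\<Sum>b\<in>B. P a b) = P1 a"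
    and P2: "\<And>b. b \<in> B \<Longrightarrow> (\<Sum>a\<in>A. P a b) = P2 b"
    and total: "sum P1 A = 1"
  shows "- (\<Sum>a\<in>A. \<Sum>b\<in>B. P a b * ln (P a b)) \<le>
    - (\<Sum>a\<in>A. P1 a * ln (P1 a)) - (\<Sum>b\<in>B. P2 b * ln (P2 b))"
proof -
  have pw: "P a b * ln (P1 a) + P a b * ln (P2 b) - P a b * ln (P a b) \<le> P1 a * P2 b - P a b"
    if ab: "a \<in> A" "b \<in> B" for a b
  proof -
    have le: "P a b \<le> P1 a" "P a b \<le> P2 b"
      unfolding P1[OF ab(1), symmetric] P2[OF ab(2), symmetric]
      using member_le_sum[of b B "P a"] member_le_sum[of a A "\<lambda>a. P a b"] ab P0 fin by auto
    show ?thesis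
    proof (cases "P a b = 0")
      case True
      thus ?thesis using le by simp
    next
      case False
      hence pos: "P a b > 0" "P1 a > 0" "P2 b > 0" using P0[OF ab] le by auto
      have "ln (P1 a * P2 b / P a b) \<le> P1 a * P2 b / P a b - 1"
        using pos by (intro ln_le_minus_one) auto
      hence "P a b * ln (P1 a * P2 b / P a b) \<le> P a b * (P1 a * P2 b / P a b - 1)"
        using pos by (intro mult_left_mono) auto
      thus ?thesis using pos by (simp add: ln_mult ln_div algebra_simps)
    qed
  qed
  have sw: "(\<Sum>a\<in>A. \<Sum>b\<in>B. P a b * f b) = (\<Sum>b\<in>B. P2 b * f b)" for f :: "'b \<Rightarrow> real"
    by (subst sum.swap) (simp add: P2 flip: sum_distrib_right)
  have t2: "sum P2 B = 1" using sw[of "\<lambda>_. 1"] total P1 by simp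
  have "(\<Sum>a\<in>A. \<Sum>b\<in>B. P a b * ln (P1 a) + P a b * ln (P2 b) - P a b * ln (P a b))
    \<le> (\<Sum>a\<in>A. \<Sum>b\<in>B. P1 a * P2 b - P a b)" by (intro sum_mono pw)
  also have "\<dots> = 0" using total t2
    by (simp add: sum_subtractf P1 flip: sum_distrib_left)
  also have "(\<Sum>a\<in>A. \<Sum>b\<in>B. P a b * ln (P1 a) + P a b * ln (P2 b) - P a b * ln (P a b)) =
    (\<Sum>a\<in>A. P1 a * ln (P1 a)) + (\<Sum>b\<in>B. P2 b * ln (P2 b)) - (\<Sum>a\<in>A. \<Sum>b\<in>B. P a b * ln (P a b))"
    by (simp add: sum_subtractf sum.distrib sw P1 flip: sum_distrib_right)
  finally show ?thesis by simp
qed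

section \<open>Words over an alphabet\<close>

definition words :: "'a set \<Rightarrow> nat \<Rightarrow> 'a list set" where
  "words A t = {xs. set xs \<subseteq> A \<and> length xs = t}"

lemma words_0 [simp]: "words A 0 = {[]}"
  by (auto simp: words_def)

lemma finite_words [simp]: "finite A \<Longrightarrow> finite (words A t)"
  unfolding words_def by (rule finite_lists_length_eq)

lemma card_words: "finite A \<Longrightarrow> card (words A t) = card A ^ t"
  unfolding words_def by (rule card_lists_length_eq)

lemma Cons_in_words [simp]: "b # e \<in> words A (Suc t) \<longleftrightarrow> b \<in> A \<and> e \<in> words A t"
  by (auto simp: words_def)

lemma words_Suc: "words A (Suc t) = (\<lambda>(b, e). b # e) ` (A \<times> words A t)"
  by (auto simp: words_def image_iff length_Suc_conv)

lemma sum_words_Suc: "(\<Sum>e\<in>words A (Suc t). f e) = (\<Sum>b\<in>A. \<Sum>e\<in>words A t. f (b # e))"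
  unfolding words_Suc by (subst sum.reindex) (auto simp: inj_on_def sum.cartesian_product case_prod_beta)

lemma sum_words_add: "(\<Sum>e\<in>words A (s + t). f e) = (\<Sum>u\<in>words A s. \<Sum>v\<in>words A t. f (u @ v))"
  by (induction s arbitrary: f) (simp_all add: sum_words_Suc)

text \<open>A finite-range substitute for a shift-invariant measure: \<open>Q_snoc\<close> is
  additivity under refinement, \<open>Q_Cons\<close> is invariance, and both are asked only for
  words shorter than \<open>T\<close>.\<close>

locale stationary_words =
  fixes A :: "'a set" and Q :: "'a list \<Rightarrow> real" and T :: nat
  assumes finA: "finite A"
    and Q0: "\<And>e. Q e \<ge> 0"
    and Q_Nil: "Q [] = 1"
    and Q_snoc: "\<And>e. e \<in> words A (length e) \<Longrightarrow> length e < T \<Longrightarrow> (\<Sum>b\<in>A. Q (e @ [b])) = Q e"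
    and Q_Cons: "\<And>e. e \<in> words A (length e) \<Longrightarrow> length e < T \<Longrightarrow> (\<Sum>b\<in>A. Q (b # e)) = Q e"
begin

definition entropy_at :: "nat \<Rightarrow> real" where
  "entropy_at t = - (\<Sum>e\<in>words A t. Q e * ln (Q e))"

lemma sum_suffix: "u \<in> words A s \<Longrightarrow> s + t \<le> T \<Longrightarrow> (\<Sum>v\<in>words A t. Q (u @ v)) = Q u"
proof (induction t arbitrary: u s)
  case (Suc t)
  have "(\<Sum>v\<in>words A (Suc t). Q (u @ v)) = (\<Sum>b\<in>A. \<Sum>v\<in>words A t. Q ((u @ [b]) @ v))"
    by (simp add: sum_words_Suc)
  also have "\<dots> = (\<Sum>b\<in>A. Q (u @ [b]))"
    using Suc.prems by (intro sum.cong refl Suc.IH[of _ "Suc s"]) (auto simp: words_def)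
  also have "\<dots> = Q u" using Suc.prems by (intro Q_snoc) (auto simp: words_def)
  finally show ?case .
qed simp

lemma sum_prefix: "v \<in> words A t \<Longrightarrow> s + t \<le> T \<Longrightarrow> (\<Sum>u\<in>words A s. Q (u @ v)) = Q v"
proof (induction s)
  case (Suc s)
  have "(\<Sum>u\<in>words A (Suc s). Q (u @ v)) = (\<Sum>u\<in>words A s. \<Sum>b\<in>A. Q (b # u @ v))"
    by (simp add: sum_words_Suc) (rule sum.swap)
  also have "\<dots> = (\<Sum>u\<in>words A s. Q (u @ v))"
    using Suc.prems by (intro sum.cong refl Q_Cons) (auto simp: words_def)
  also have "\<dots> = Q v" using Suc by simp
  finally show ?case .
qed simp

lemma sum_Q: "t \<le> T \<Longrightarrow> (\<Sum>e\<in>words A t. Q e) = 1"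
  using sum_suffix[of "[]" 0 t] by (simp add: Q_Nil)

lemma Q_le_1: "e \<in> words A t \<Longrightarrow> t \<le> T \<Longrightarrow> Q e \<le> 1"
  using member_le_sum[of e "words A t" Q] sum_Q[of t] Q0 finA by auto

text \<open>By stationarity the law of the last \<open>t\<close> letters is again given by
  \<open>Q\<close>, so the second marginal in the subadditivity inequality yields
  \<open>entropy_at t\<close>.\<close>

lemma entropy_add: "s + t \<le> T \<Longrightarrow> entropy_at (s + t) \<le> entropy_at s + entropy_at t"
proof -
  assume st: "s + t \<le> T"
  have "- (\<Sum>u\<in>words A s. \<Sum>v\<in>words A t. Q (u @ v) * ln (Q (u @ v))) \<le>
    - (\<Sum>u\<in>words A s. Q u * ln (Q u)) - (\<Sum>v\<in>words A t. Q v * ln (Q v))"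
    by (rule entropy_subadditive) (use st finA sum_Q[of s] in \<open>auto simp: Q0 intro!: sum_suffix sum_prefix\<close>)
  thus ?thesis unfolding entropy_at_def sum_words_add by simp
qed

lemma entropy_nonneg: "t \<le> T \<Longrightarrow> entropy_at t \<ge> 0"
proof -
  assume t: "t \<le> T"
  have "Q e * ln (Q e) \<le> 0" if "e \<in> words A t" for e
    using Q0[of e] Q_le_1[OF that t] by (cases "Q e = 0") (auto simp: mult_le_0_iff)
  thus ?thesis unfolding entropy_at_def by (simp add: sum_nonpos)
qed

text \<open>Crude, from \<open>- x * ln x <= 1\<close> for each word, but independent of
  \<open>T\<close>; it serves for the remainder of a division by \<open>m\<close>.\<close>

lemma entropy_le_card: "entropy_at t \<le> real (card A ^ t)"
proof -
  have "- (Q e * ln (Q e)) \<le> 1" for e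
  proof (cases "Q e = 0")
    case False
    hence pos: "Q e > 0" using Q0[of e] by simp
    have "ln (1 / Q e) \<le> 1 / Q e - 1" using pos by (intro ln_le_minus_one) auto
    hence "Q e * ln (1 / Q e) \<le> Q e * (1 / Q e - 1)" using pos by (intro mult_left_mono) auto
    thus ?thesis using pos by (simp add: ln_div algebra_simps)
  qed simp
  hence "(\<Sum>e\<in>words A t. - (Q e * ln (Q e))) \<le> (\<Sum>e\<in>words A t. 1)" by (intro sum_mono)
  thus ?thesis using finA by (simp add: entropy_at_def sum_negf card_words)
qed

lemma entropy_mult: "q * m + r \<le> T \<Longrightarrow> entropy_at (q * m + r) \<le> real q * entropy_at m + entropy_at r"
proof (induction q)
  case (Suc q)
  have "entropy_at (Suc q * m + r) \<le> entropy_at m + entropy_at (q * m + r)"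
    using entropy_add[of m "q * m + r"] Suc.prems by (simp add: add.assoc)
  thus ?case using Suc by (simp add: algebra_simps)
qed simp

text \<open>Divide \<open>T\<close> by \<open>m\<close>: subadditivity handles the full blocks, and
  the remaining fewer than \<open>m\<close> letters cost at most a constant that vanishes after
  division by \<open>T\<close>.\<close>

lemma entropy_le_linear:
  assumes m: "0 < m" "m \<le> T"
  shows "entropy_at T \<le> real T / real m * entropy_at m + real (card A ^ m)"
proof -
  have "A \<noteq> {}"
  proof
    assume "A = {}"
    hence "words A m = {}" using m by (auto simp: words_def)
    thus False using sum_Q[OF m(2)] by simp
  qed
  hence A1: "card A \<ge> 1" using finA by (simp add: Suc_leI card_gt_0_iff)
  have "entropy_at T \<le> real (T div m) * entropy_at m + entropy_at (T mod m)"
    using entropy_mult[of "T div m" m "T mod m"] by simp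
  also have "\<dots> \<le> real T / real m * entropy_at m + real (card A ^ m)"
  proof (intro add_mono mult_right_mono entropy_nonneg[OF m(2)])
    show "real (T div m) \<le> real T / real m" 
      using m by (simp add: pos_le_divide_eq flip: of_nat_mult)
    have "card A ^ (T mod m) \<le> card A ^ m" using A1 m
      by (intro power_increasing) (auto intro: less_imp_le)
    thus "entropy_at (T mod m) \<le> real (card A ^ m)"
      using entropy_le_card[of "T mod m"] by linarith
  qed
  finally show ?thesis .
qed

text \<open>Split off the first letter: summing out the suffix leaves the one-letter law, and
  summing out the first letter leaves a shorter word by stationarity. Every position thus
  contributes the same mean.\<close>

lemma sum_additive:
  fixes f :: "'a \<Rightarrow> real"
  shows "t \<le> T \<Longrightarrow> (\<Sum>e\<in>words A t. Q e * (\<Sum>x\<leftarrow>e. f x)) = real t * (\<Sum>b\<in>A. Q [b] * f b)"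
proof (induction t)
  case (Suc t)
  have "(\<Sum>e\<in>words A (Suc t). Q e * (\<Sum>x\<leftarrow>e. f x)) =
     (\<Sum>b\<in>A. f b * (\<Sum>e\<in>words A t. Q ([b] @ e))) + (\<Sum>b\<in>A. \<Sum>e\<in>words A t. Q (b # e) * (\<Sum>x\<leftarrow>e. f x))"
    by (simp add: sum_words_Suc sum.distrib distrib_left sum_distrib_left mult_ac)
  also have "(\<Sum>b\<in>A. f b * (\<Sum>e\<in>words A t. Q ([b] @ e))) = (\<Sum>b\<in>A. f b * Q [b])"
    using Suc.prems by (intro sum.cong refl arg_cong2[where f = "(*)"] sum_suffix[of _ 1]) (auto simp: words_def)
  also have "(\<Sum>b\<in>A. \<Sum>e\<in>words A t. Q (b # e) * (\<Sum>x\<leftarrow>e. f x)) =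
      (\<Sum>e\<in>words A t. (\<Sum>b\<in>A. Q (b # e)) * (\<Sum>x\<leftarrow>e. f x))"
    by (subst sum.swap) (simp add: sum_distrib_right)
  also have "\<dots> = (\<Sum>e\<in>words A t. Q e * (\<Sum>x\<leftarrow>e. f x))"
    using Suc.prems by (intro sum.cong refl arg_cong2[where f = "(*)"] Q_Cons) (auto simp: words_def)
  finally show ?case using Suc by (simp add: algebra_simps)
qed simp

text \<open>A transition into a constant stretch is rare: the differences \<open>Q (c^j) - Q (c^(j+1))\<close> telescope,
  and each of them bounds \<open>Q (b c^M)\<close>.\<close>

lemma Q_Cons_replicate_le:
  assumes bc: "b \<in> A" "c \<in> A" "b \<noteq> c" and M: "Suc M \<le> T"
  shows "real M * Q (b # replicate M c) \<le> 1"
proof -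
  have rep: "replicate j c \<in> words A j" for j using bc by (auto simp: words_def)
  have mono: "Q (b # replicate M c) \<le> Q (b # replicate j c)" if "j \<le> M" for j
  proof -
    have "Q (b # replicate M c) = Q ((b # replicate j c) @ replicate (M - j) c)"
      using that by (simp flip: replicate_add)
    also have "\<dots> \<le> (\<Sum>v\<in>words A (M - j). Q ((b # replicate j c) @ v))"
      using rep finA by (intro member_le_sum) (auto simp: Q0)
    also have "\<dots> = Q (b # replicate j c)"
      using that M rep bc by (intro sum_suffix[of _ "Suc j"]) auto
    finally show ?thesis .
  qed
  have step: "Q (b # replicate M c) \<le> Q (replicate j c) - Q (replicate (Suc j) c)" if "j < M" for j
  proof -
    have "Q (b # replicate j c) + Q (c # replicate j c) = (\<Sum>x\<in>{b, c}. Q (x # replicate j c))"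
      using bc by simp
    also have "\<dots> \<le> (\<Sum>x\<in>A. Q (x # replicate j c))"
      using bc finA by (intro sum_mono2) (auto simp: Q0)
    also have "\<dots> = Q (replicate j c)" using that M rep by (intro Q_Cons) auto
    finally show ?thesis using mono[of j] that by simp
  qed
  have "(\<Sum>j<M. Q (b # replicate M c)) \<le> (\<Sum>j<M. Q (replicate j c) - Q (replicate (Suc j) c))"
    by (intro sum_mono step) auto
  also have "\<dots> = Q [] - Q (replicate M c)" by (subst sum_lessThan_telescope') simp
  also have "\<dots> \<le> 1" using Q0 by (simp add: Q_Nil)
  finally show ?thesis by simp
qed

lemma Q_append_le: "u \<in> words A s \<Longrightarrow> v \<in> words A t \<Longrightarrow> s + t \<le> T \<Longrightarrow> Q (u @ v) \<le> Q v"
  using member_le_sum[of u "words A s" "\<lambda>u. Q (u @ v)"] sum_prefix[of v t s] finA Q0 by auto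

end

section \<open>Cylinders\<close>

locale power_slopes =
  fixes p l :: nat and n :: "nat \<Rightarrow> nat"
  assumes p2: "p \<ge> 2" and n1: "\<And>j. j < l \<Longrightarrow> n j \<ge> 1"
    and slopes_sum: "(\<Sum>j<l. 1 / real p ^ n j) = 1"
begin

abbreviation W :: "nat \<Rightarrow> nat list set" where "W \<equiv> words {..<l}"

text \<open>The composed inverse branch along the word, evaluated at 0; \<open>cyl_right\<close> is
  its value at 1.\<close>

fun cyl_left :: "nat list \<Rightarrow> real" where
  "cyl_left [] = 0"
| "cyl_left (b # e) = lend p n b + cyl_left e / Lam p n b"

definition cyl_slope :: "nat list \<Rightarrow> real" where
  "cyl_slope e = (\<Prod>b\<leftarrow>e. Lam p n b)"

definition cyl_right :: "nat list \<Rightarrow> real" where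
  "cyl_right e = cyl_left e + 1 / cyl_slope e"

definition cyl :: "nat list \<Rightarrow> real set" where
  "cyl e = {cyl_left e ..< cyl_right e}"

lemma cyl_slope_simps [simp]:
  "cyl_slope [] = 1" "cyl_slope (b # e) = Lam p n b * cyl_slope e"
  "cyl_slope (u @ v) = cyl_slope u * cyl_slope v"
  by (auto simp: cyl_slope_def)

lemma lam_pos [simp]: "Lam p n b > 0"
  using p2 by (simp add: Lam_def)

lemma lam_nz [simp]: "Lam p n b \<noteq> 0"
  using lam_pos[of b] by linarith

lemma cyl_slope_pos [simp]: "cyl_slope e > 0"
  by (induction e) auto

lemma cyl_slope_nz [simp]: "cyl_slope e \<noteq> 0"
  using cyl_slope_pos[of e] by linarith

lemma ln_cyl_slope: "ln (cyl_slope e) = (\<Sum>b\<leftarrow>e. ln (Lam p n b))"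
  by (induction e) (simp_all add: ln_mult)

lemma cyl_right_Cons: "cyl_right (b # e) = lend p n b + cyl_right e / Lam p n b"
  by (simp add: cyl_right_def add_divide_distrib mult.commute)

lemma cyl_right_Nil [simp]: "cyl_right [] = 1"
  by (simp add: cyl_right_def)

lemma cyl_left_append: "cyl_left (u @ v) = cyl_left u + cyl_left v / cyl_slope u"
  by (induction u) (simp_all add: field_simps)

lemma cyl_right_append: "cyl_right (u @ v) = cyl_left u + cyl_right v / cyl_slope u"
  by (simp add: cyl_right_def cyl_left_append field_simps)

lemma cyl_left_less_right: "cyl_left e < cyl_right e"
  by (simp add: cyl_right_def)

lemma lend_0 [simp]: "lend p n 0 = 0"
  by (simp add: lend_def)

lemma lend_Suc: "lend p n (Suc b) = lend p n b + 1 / Lam p n b"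
  by (simp add: lend_def)

lemma lend_l [simp]: "lend p n l = 1"
  using slopes_sum by (simp add: lend_def Lam_def)

lemma lend_mono: "a \<le> b \<Longrightarrow> lend p n a \<le> lend p n b"
  by (rule lift_Suc_mono_le[of "lend p n"]) (auto simp: lend_Suc order.strict_implies_order[OF lam_pos])

lemma lend_nonneg: "lend p n b \<ge> 0"
  using lend_mono[of 0 b] by simp

lemma l_pos: "l > 0"
  using slopes_sum by (cases l) auto

lemma cyl_bounds: "e \<in> W t \<Longrightarrow> 0 \<le> cyl_left e \<and> cyl_right e \<le> 1"
proof (induction e arbitrary: t)
  case (Cons b e)
  hence b: "b < l" and e: "e \<in> W (length e)" by (auto simp: words_def)
  have "lend p n b + cyl_right e / Lam p n b \<le> lend p n (Suc b)"
    using Cons.IH[OF e] by (simp add: lend_Suc divide_right_mono order.strict_implies_order[OF lam_pos])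
  also have "\<dots> \<le> 1" using lend_mono[of "Suc b" l] b by simp
  finally show ?case using Cons.IH[OF e]
    by (simp add: cyl_right_Cons lend_nonneg order.strict_implies_order[OF lam_pos])
qed simp

lemma cyl_subset: "e \<in> W t \<Longrightarrow> cyl e \<subseteq> {0..<1}"
  using cyl_bounds[of e t] by (auto simp: cyl_def)

lemma cyl_Nil: "cyl [] = {0..<1}"
  by (simp add: cyl_def)

lemma in_cyl_Cons: "x \<in> cyl (b # e) \<longleftrightarrow> Lam p n b * (x - lend p n b) \<in> cyl e"
  by (simp add: cyl_def cyl_right_Cons field_simps)

lemma in_cyl_append: "x \<in> cyl (u @ v) \<longleftrightarrow> cyl_slope u * (x - cyl_left u) \<in> cyl v"
  by (simp add: cyl_def cyl_left_append cyl_right_append field_simps)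

lemma in_cyl_single: "x \<in> cyl [b] \<longleftrightarrow> lend p n b \<le> x \<and> x < lend p n (Suc b)"
  by (auto simp: cyl_def cyl_right_Cons lend_Suc)

lemma cyl_ConsD:
  assumes "x \<in> cyl (b # e)" "e \<in> W t"
  shows "x \<in> cyl [b]"
proof -
  have "Lam p n b * (x - lend p n b) \<in> cyl []"
    using assms cyl_subset[OF assms(2)] by (auto simp: in_cyl_Cons cyl_Nil)
  thus ?thesis by (simp add: in_cyl_Cons)
qed

lemma cyl_single_disjoint:
  assumes "x \<in> cyl [a]" "x \<in> cyl [b]"
  shows "a = b"
proof (rule ccontr)
  assume "a \<noteq> b"
  then consider "Suc a \<le> b" | "Suc b \<le> a" by linarith
  thus False using lend_mono[of "Suc a" b] lend_mono[of "Suc b" a] assms by cases (auto simp: in_cyl_single)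
qed

lemma cyl_single_exists:
  assumes "0 \<le> x" "x < 1"
  shows "\<exists>b<l. x \<in> cyl [b]"
proof -
  define c where "c = (LEAST c. x < lend p n c)"
  have ex: "x < lend p n l" using assms by simp
  have c: "x < lend p n c" unfolding c_def by (rule LeastI[of _ l]) (rule ex)
  have cl: "c \<le> l" unfolding c_def by (rule Least_le) (rule ex)
  have "c \<noteq> 0" using c assms by (intro notI) simp
  then obtain b where b: "c = Suc b" by (cases c) auto
  have "\<not> x < lend p n b" using not_less_Least[of b "\<lambda>c. x < lend p n c"] b by (simp add: c_def)
  thus ?thesis using b c cl by (intro exI[of _ b]) (auto simp: in_cyl_single)
qed

lemma cyl_exists:
  assumes "0 \<le> x" "x < 1"
  shows "\<exists>e\<in>W t. x \<in> cyl e"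
  using assms
proof (induction t arbitrary: x)
  case 0
  thus ?case by (auto simp: cyl_Nil)
next
  case (Suc t)
  obtain b where b: "b < l" "x \<in> cyl [b]" using cyl_single_exists[OF Suc.prems] by blast
  have "Lam p n b * (x - lend p n b) \<in> {0..<1}" using b(2) by (simp add: in_cyl_Cons cyl_Nil)
  then obtain e where "e \<in> W t" "Lam p n b * (x - lend p n b) \<in> cyl e" using Suc.IH by auto
  thus ?case using b by (intro bexI[of _ "b # e"]) (auto simp: in_cyl_Cons)
qed

lemma cyl_disjoint:
  assumes "x \<in> cyl e" "x \<in> cyl e'" "e \<in> W t" "e' \<in> W t"
  shows "e = e'"
  using assms
proof (induction t arbitrary: x e e')
  case (Suc t)
  obtain b f where e: "e = b # f" "f \<in> W t" using Suc.prems(3) by (auto simp: words_Suc)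
  obtain b' f' where e': "e' = b' # f'" "f' \<in> W t" using Suc.prems(4) by (auto simp: words_Suc)
  have "b = b'" using cyl_ConsD[of x b f] cyl_ConsD[of x b' f'] Suc.prems e e' cyl_single_disjoint by blast
  moreover from this have "f = f'" using Suc.prems e e' by (intro Suc.IH[of "Lam p n b * (x - lend p n b)"]) (auto simp: in_cyl_Cons)
  ultimately show ?case using e e' by simp
qed simp

lemma cyl_snoc_exists:
  assumes "x \<in> cyl e"
  shows "\<exists>b<l. x \<in> cyl (e @ [b])"
proof -
  have "cyl_slope e * (x - cyl_left e) \<in> cyl []" using assms by (simp flip: in_cyl_append)
  thus ?thesis unfolding in_cyl_append by (intro cyl_single_exists) (auto simp: cyl_Nil)
qed

lemma cyl_appendD:
  assumes "x \<in> cyl (e @ f)" "f \<in> W t"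
  shows "x \<in> cyl e"
proof -
  have "cyl_slope e * (x - cyl_left e) \<in> cyl []"
    using assms cyl_subset[of f t] by (auto simp: in_cyl_append cyl_Nil)
  thus ?thesis by (simp flip: in_cyl_append)
qed

lemma cyl_snoc_disjoint: "x \<in> cyl (e @ [a]) \<Longrightarrow> x \<in> cyl (e @ [b]) \<Longrightarrow> a = b"
  unfolding in_cyl_append by (rule cyl_single_disjoint)

definition code :: "nat \<Rightarrow> real \<Rightarrow> nat list" where
  "code t x = (THE e. e \<in> W t \<and> x \<in> cyl e)"

lemma code_eq_iff:
  assumes "0 \<le> x" "x < 1" "e \<in> W t"
  shows "code t x = e \<longleftrightarrow> x \<in> cyl e"
proof -
  have ex1: "\<exists>!e. e \<in> W t \<and> x \<in> cyl e" using cyl_exists[OF assms(1,2)] cyl_disjoint by blast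
  from theI'[OF this] have "code t x \<in> W t" "x \<in> cyl (code t x)" by (auto simp: code_def)
  thus ?thesis using assms(3) cyl_disjoint by blast
qed

lemma code_in_words: "0 \<le> x \<Longrightarrow> x < 1 \<Longrightarrow> code t x \<in> W t"
  using cyl_exists[of x t] code_eq_iff by metis

section \<open>Integrality of cylinder end points\<close>

lemma pow_lend_Nats:
  assumes "\<And>b. b < l \<Longrightarrow> n b \<le> k" "b \<le> l"
  shows "real p ^ k * lend p n b \<in> \<nat>"
proof -
  have "real p ^ k * lend p n b = (\<Sum>i<b. real p ^ (k - n i))"
    unfolding lend_def sum_distrib_left
  proof (rule sum.cong)
    fix i assume "i \<in> {..<b}"
    hence "n i \<le> k" using assms by auto
    thus "real p ^ k * (1 / Lam p n i) = real p ^ (k - n i)" using p2 by (simp add: Lam_def power_diff)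
  qed simp
  also have "\<dots> = of_nat (\<Sum>i<b. p ^ (k - n i))" by simp
  finally show ?thesis by (simp only: of_nat_in_Nats)
qed

text \<open>The inverse branch of a letter \<open>b\<close> divides by \<open>p ^ n b\<close> with
  \<open>n b <= d\<close>, so \<open>t * d\<close> factors \<open>p\<close> clear all denominators
  of a word of length \<open>t\<close>.\<close>

lemma pow_cyl_Nats:
  assumes d: "\<And>b. b < l \<Longrightarrow> n b \<le> d" and e: "e \<in> W t" and k: "t * d \<le> k"
  shows "real p ^ k * cyl_left e \<in> \<nat> \<and> real p ^ k / cyl_slope e \<in> \<nat>"
  using e k
proof (induction e arbitrary: t k)
  case Nil
  thus ?case by (simp flip: of_nat_power)
next
  case (Cons b e)
  obtain s where t: "t = Suc s" using Cons.prems by (cases t) (auto simp: words_def)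
  have b: "b < l" and e: "e \<in> W s" using Cons.prems t by auto
  have kd: "d \<le> k" "s * d \<le> k - n b" using Cons.prems d[OF b] t by auto
  hence nb: "n b \<le> k" using d[OF b] by linarith
  have q: "real p ^ k / Lam p n b = real p ^ (k - n b)" using nb p2 by (simp add: Lam_def power_diff)
  have "real p ^ k * cyl_left (b # e) = real p ^ k * lend p n b + real p ^ (k - n b) * cyl_left e"
    by (simp add: distrib_left flip: q)
  moreover have "real p ^ k / cyl_slope (b # e) = real p ^ (k - n b) / cyl_slope e"
    by (simp flip: q)
  moreover have "real p ^ k * lend p n b \<in> \<nat>"
    using b d kd by (intro pow_lend_Nats) (auto intro: order_trans)
  ultimately show ?case using Cons.IH[OF e kd(2)] by auto
qed

lemma pow_cyl_right_Nats:
  assumes d: "\<And>b. b < l \<Longrightarrow> n b \<le> d" and e: "e \<in> W t" and k: "t * d \<le> k"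
  shows "real p ^ k * cyl_right e \<in> \<nat>"
proof -
  have "real p ^ k * cyl_right e = real p ^ k * cyl_left e + real p ^ k / cyl_slope e"
    by (simp add: cyl_right_def distrib_left)
  thus ?thesis using pow_cyl_Nats[OF d e k] by auto
qed

section \<open>Shared end points of adjacent cylinders\<close>

lemma cyl_left_snoc_0: "cyl_left (u @ [0]) = cyl_left u"
  by (simp add: cyl_left_append)

lemma cyl_right_last: "cyl_right [l - 1] = 1"
  using l_pos lend_Suc[of "l - 1"] by (simp add: cyl_right_def)

lemma cyl_right_snoc_last: "cyl_right (u @ [l - 1]) = cyl_right u"
  unfolding cyl_right_append cyl_right_last by (simp add: cyl_right_def)

lemma cyl_left_append_0: "cyl_left (u @ replicate M 0) = cyl_left u"
proof -
  have "cyl_left (replicate M 0) = 0" by (induction M) auto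
  thus ?thesis by (simp add: cyl_left_append)
qed

lemma cyl_right_append_last: "cyl_right (u @ replicate M (l - 1)) = cyl_right u"
proof -
  have "cyl_right (replicate M (l - 1)) = 1"
  proof (induction M)
    case (Suc M)
    thus ?case using cyl_right_last by (simp add: cyl_right_Cons)
  qed simp
  thus ?thesis unfolding cyl_right_append by (simp add: cyl_right_def)
qed

lemma cyl_right_snoc: "cyl_right (u @ [b]) = cyl_left (u @ [Suc b])"
  by (simp add: cyl_right_append cyl_left_append cyl_right_Cons lend_Suc)

text \<open>Trailing zeros do not move the left end, so they are stripped until a nonzero last
  letter appears. The point is then the junction of the cylinders of \<open>u @ [b - 1]\<close> and
  \<open>u @ [b]\<close>, the form that \<open>boundary_null\<close> treats.\<close>

lemma cyl_left_boundary:
  assumes "e \<in> W t" "cyl_left e \<noteq> 0"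
  shows "\<exists>u b. u @ [b] \<in> W (Suc (length u)) \<and> b > 0 \<and> cyl_left e = cyl_left (u @ [b])"
  using assms
proof (induction e arbitrary: t rule: rev_induct)
  case (snoc b e)
  show ?case
  proof (cases "b = 0")
    case True
    thus ?thesis using snoc.IH[of "length e"] snoc.prems by (auto simp: cyl_left_snoc_0 words_def)
  qed (use snoc.prems in \<open>auto simp: words_def\<close>)
qed simp

text \<open>Trailing letters \<open>l - 1\<close> do not move the right end. The last other letter
  is raised by one, since a right end is the left end of the next sibling; this gives the same
  normal form as for left ends.\<close>

lemma cyl_right_boundary:
  assumes "e \<in> W t" "cyl_right e \<noteq> 1"
  shows "\<exists>u b. u @ [b] \<in> W (Suc (length u)) \<and> b > 0 \<and> cyl_right e = cyl_left (u @ [b])"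
  using assms
proof (induction e arbitrary: t rule: rev_induct)
  case (snoc b e)
  show ?case
  proof (cases "b = l - 1")
    case True
    thus ?thesis using snoc.IH[of "length e"] snoc.prems cyl_right_snoc_last[of e] by (auto simp: words_def)
  next
    case False
    thus ?thesis using snoc.prems
      by (intro exI[of _ e] exI[of _ "Suc b"]) (auto simp: words_def cyl_right_snoc)
  qed
qed simp

section \<open>Itineraries under the map\<close>

lemma Iv_eq: "b < l \<Longrightarrow> x \<in> Iv p l n b \<longleftrightarrow> x \<in> cyl [b] \<or> (x = 1 \<and> b = l - 1)"
  using lend_mono[of b l] l_pos
  by (cases "Suc b = l") (auto simp: Iv_def in_cyl_single)

lemma Iv_disjoint: "a < l \<Longrightarrow> b < l \<Longrightarrow> x \<in> Iv p l n a \<Longrightarrow> x \<in> Iv p l n b \<Longrightarrow> a = b"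
  using cyl_single_disjoint[of x a b] cyl_subset[of "[a]" 1] cyl_subset[of "[b]" 1]
  by (auto simp: Iv_eq words_def)

lemma Tp_eq:
  assumes "b < l" "x \<in> Iv p l n b"
  shows "Tp p l n x = Lam p n b * (x - lend p n b)"
proof -
  have "Tp p l n x = (\<Sum>j\<in>{b}. indicator (Iv p l n j) x * (Lam p n j * (x - lend p n j)))"
    unfolding Tp_def using assms Iv_disjoint by (intro sum.mono_neutral_right) (auto simp: indicator_def)
  thus ?thesis using assms by simp
qed

lemma Tp_1: "Tp p l n 1 = 1"
proof -
  have "Tp p l n 1 = Lam p n (l - 1) * (1 - lend p n (l - 1))"
    using l_pos by (intro Tp_eq) (auto simp: Iv_eq)
  thus ?thesis using cyl_right_last by (simp add: cyl_right_Cons field_simps)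
qed

lemma Iv_cover: "(\<Union>b<l. Iv p l n b) = {0..1}"
proof -
  have "x \<in> (\<Union>b<l. Iv p l n b)" if "x \<in> {0..1}" for x
    using that cyl_single_exists[of x] l_pos by (cases "x = 1") (auto simp: Iv_eq)
  moreover have "x \<in> {0..1}" if "b < l" "x \<in> Iv p l n b" for x b
    using that cyl_subset[of "[b]" 1] by (auto simp: Iv_eq words_def)
  ultimately show ?thesis by blast
qed

text \<open>The last interval is closed and 1 is a fixed point in it, so 1 has the constant
  itinerary \<open>l - 1\<close>. Adding it to these cylinders turns half-open cylinders into exact
  itinerary sets.\<close>

definition ccyl :: "nat list \<Rightarrow> real set" where
  "ccyl e = cyl e \<union> (if set e \<subseteq> {l - 1} then {1} else {})"

lemma ccyl_Cons:
  assumes "b < l" "e \<in> W t"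
  shows "x \<in> ccyl (b # e) \<longleftrightarrow> x \<in> Iv p l n b \<and> Tp p l n x \<in> ccyl e"
proof (cases "x = 1")
  case True
  have "1 \<notin> cyl (b # e)" "1 \<notin> cyl e" "1 \<notin> cyl [b]"
    using cyl_subset[of "b # e" "Suc t"] cyl_subset[of e t] cyl_subset[of "[b]" 1] assms
    by (auto simp: words_def)
  thus ?thesis using True assms by (auto simp: ccyl_def Iv_eq Tp_1)
next
  case False
  show ?thesis
  proof (cases "x \<in> cyl [b]")
    case True
    hence iv: "x \<in> Iv p l n b" using assms by (simp add: Iv_eq)
    have "Tp p l n x \<noteq> 1" using True unfolding Tp_eq[OF assms(1) iv] by (simp add: in_cyl_Cons cyl_Nil)
    thus ?thesis using iv False by (simp add: ccyl_def in_cyl_Cons Tp_eq[OF assms(1) iv])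
  next
    case no: False
    thus ?thesis using False assms cyl_ConsD[of x b e t] by (auto simp: ccyl_def Iv_eq)
  qed
qed

lemma ccyl_itinerary:
  assumes "e \<in> W t"
  shows "x \<in> ccyl e \<longleftrightarrow> x \<in> {0..1} \<and> (\<forall>i<t. (Tp p l n ^^ i) x \<in> Iv p l n (e ! i))"
  using assms
proof (induction t arbitrary: e x)
  case 0
  thus ?case by (auto simp: ccyl_def cyl_Nil)
next
  case (Suc t)
  obtain b f where e: "e = b # f" "b < l" "f \<in> W t" using Suc.prems by (auto simp: words_Suc)
  have "y \<in> {0..1}" if "y \<in> Iv p l n b" for y using Iv_cover that e by blast
  moreover have "Tp p l n x \<in> {0..1}" if "x \<in> Iv p l n b"
  proof (cases "x = 1")
    case False
    hence "x \<in> cyl [b]" using that e by (simp add: Iv_eq)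
    thus ?thesis using that e by (simp add: Tp_eq in_cyl_Cons cyl_Nil)
  qed (simp add: Tp_1)
  ultimately show ?case using e
    by (auto simp: ccyl_Cons[OF e(2,3)] Suc.IH[OF e(3)] All_less_Suc2 funpow_swap1)
qed
end

section \<open>Quantized maps\<close>

text \<open>With \<open>d\<close> bounding the exponents, cylinders of length \<open>t\<close> are unions of cells when \<open>t * d \<le> k\<close>.\<close>

locale quantized = power_slopes +
  fixes k d :: nat and U :: "nat \<Rightarrow> nat \<Rightarrow> complex" and \<psi> :: "nat \<Rightarrow> complex"
  assumes quant: "quantization (Tp p l n) (p ^ k) U"
    and eigv: "normalized_eigenvector (p ^ k) U \<psi>"
    and d: "\<And>b. b < l \<Longrightarrow> n b \<le> d" and d1: "d \<ge> 1" and dk: "d \<le> k"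
begin

abbreviation "N \<equiv> p ^ k"

abbreviation gr :: "nat \<Rightarrow> real" where "gr j \<equiv> real j / real N"

lemma N_pos: "N > 0"
  using p2 by simp

lemma gr_bounds [simp]: "0 \<le> gr j" "j < N \<Longrightarrow> gr j < 1"
  using N_pos by (auto simp: divide_less_eq simp del: of_nat_power)

lemma gr_bound_power [simp]: "j < N \<Longrightarrow> real j / real p ^ k < 1"
  using gr_bounds(2)[of j] by simp

lemma gr_less_iff: "gr a < gr b \<longleftrightarrow> a < b" and gr_le_iff: "gr a \<le> gr b \<longleftrightarrow> a \<le> b"
  using N_pos by (auto simp: divide_less_cancel divide_le_cancel simp del: of_nat_power)

section \<open>Entries of the quantized map\<close>

lemma Bmat_entry: "i < N \<Longrightarrow> j < N \<Longrightarrow> Bmat (Tp p l n) N j i = (cmod (U i j))\<^sup>2"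
  using quant by (simp add: quantization_def)

lemma U_orth: "i < N \<Longrightarrow> j < N \<Longrightarrow> (\<Sum>m<N. cnj (U m i) * U m j) = (if i = j then 1 else 0)"
  using quant by (simp add: quantization_def)

lemma N_cyl_Nats:
  assumes "e \<in> W t" "t * d \<le> k"
  obtains a b where "cyl_left e = real a / real N" "cyl_right e = real b / real N"
proof -
  have "real N * cyl_left e \<in> \<nat>" "real N * cyl_right e \<in> \<nat>"
    using pow_cyl_Nats[OF d assms] pow_cyl_right_Nats[OF d assms] by auto
  then obtain a b where "real N * cyl_left e = real a" "real N * cyl_right e = real b"
    by (auto simp: Nats_def simp del: of_nat_power)
  thus ?thesis using N_pos that[of a b] by (simp add: field_simps del: of_nat_power)
qed

text \<open>\<open>cyl_right e\<close> is itself a grid point, so it cannot fall strictly inside a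
  cell. Cells can therefore be assigned to cylinders by their left ends.\<close>

lemma in_cyl_grid:
  assumes "e \<in> W t" "t * d \<le> k" "gr j \<in> cyl e"
  shows "gr (Suc j) \<le> cyl_right e"
proof -
  obtain a b where "cyl_left e = real a / real N" "cyl_right e = real b / real N"
    using N_cyl_Nats[OF assms(1,2)] by blast
  thus ?thesis using assms(3) by (simp only: cyl_def atLeastLessThan_iff gr_less_iff gr_le_iff Suc_le_eq)
qed

text \<open>The squared modulus is \<open>N\<close> times the length of the part of cell
  \<open>j\<close> mapped into cell \<open>i\<close>. On branch \<open>b\<close> this part is an
  interval of length at most \<open>1 / (N * Lam p n b)\<close>, up to one point. By integrality of
  the rescaled end points, positive length forces cell \<open>i\<close> into the image of cell
  \<open>j\<close>.\<close>

lemma U_entry: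
  assumes ij: "i < N" "j < N" and b: "b < l" "gr j \<in> cyl [b]"
  shows "(cmod (U i j))\<^sup>2 \<le> 1 / Lam p n b"
    and "U i j \<noteq> 0 \<Longrightarrow> Lam p n b * (gr j - lend p n b) \<le> gr i \<and> gr (Suc i) \<le> Lam p n b * (gr (Suc j) - lend p n b)"
proof -
  define N' where "N' = real N"
  have N': "N' > 0" using N_pos by (simp add: N'_def)
  define \<Lambda> where "\<Lambda> = Lam p n b"
  have \<Lambda>: "\<Lambda> > 0" by (simp add: \<Lambda>_def)
  define a where "a = lend p n b"
  define S where "S = {x \<in> Ecell N j. Tp p l n x \<in> Ecell N i}"
  define lo where "lo = max (j / N') (a + i / N' / \<Lambda>)"
  define hi where "hi = min (Suc j / N') (a + Suc i / N' / \<Lambda>)"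
  have bW: "[b] \<in> W 1" using b by (simp add: words_def)
  have nxt: "Suc j / N' \<le> lend p n (Suc b)"
    using in_cyl_grid[OF bW _ b(2)] dk by (simp add: N'_def cyl_right_Cons lend_Suc)
  \<comment> \<open>The right end of cell \<open>j\<close> may belong to the next branch, where
    \<open>Tp\<close> jumps; as a single point it adds no length.\<close>
  have sub: "S \<subseteq> {lo..hi} \<union> {Suc j / N'}"
  proof
    fix x assume x: "x \<in> S"
    show "x \<in> {lo..hi} \<union> {Suc j / N'}"
    proof (cases "x = Suc j / N'")
      case False
      hence xj: "j / N' \<le> x" "x < Suc j / N'" using x by (auto simp: S_def Ecell_def N'_def)
      hence "x \<in> cyl [b]" using b nxt by (auto simp: in_cyl_single N'_def)
      hence "Tp p l n x = \<Lambda> * (x - a)" using b by (simp add: Tp_eq Iv_eq \<Lambda>_def a_def)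
      hence "i / N' \<le> \<Lambda> * (x - a)" "\<Lambda> * (x - a) \<le> Suc i / N'"
        using x by (auto simp: S_def Ecell_def N'_def)
      hence "i / N' / \<Lambda> \<le> x - a" "x - a \<le> Suc i / N' / \<Lambda>"
        using \<Lambda> by (auto simp: pos_divide_le_eq pos_le_divide_eq mult.commute simp del: divide_divide_eq_left)
      thus ?thesis using xj by (simp add: lo_def hi_def)
    qed simp
  qed
  have fm: "{lo..hi} \<union> {Suc j / N'} \<in> fmeasurable lborel"
    by (intro fmeasurable.Un) (auto simp: fmeasurable_def emeasure_lborel_Icc_eq)
  \<comment> \<open>A set outside \<open>sets lborel\<close> has \<open>measure\<close> 0 by
    default, which also satisfies the bound.\<close>
  have S_le: "measure lborel S \<le> measure lborel {lo..hi}"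
  proof (cases "S \<in> sets lborel")
    case True
    have "measure lborel S \<le> measure lborel ({lo..hi} \<union> {Suc j / N'})"
      by (rule measure_mono_fmeasurable[OF sub True fm])
    also have "\<dots> \<le> measure lborel {lo..hi} + measure lborel {Suc j / N'}"
      by (intro measure_Un_le) auto
    finally show ?thesis by (simp add: measure_def)
  qed (simp add: measure_notin_sets)
  have E: "measure lborel (Ecell N j) = 1 / N'"
    unfolding Ecell_def using N' by (simp add: N'_def divide_right_mono add_divide_distrib)
  have UB: "(cmod (U i j))\<^sup>2 = measure lborel S * N'"
    using Bmat_entry[OF ij] N' by (simp add: Bmat_def E S_def)
  have mI: "measure lborel {lo..hi} = max 0 (hi - lo)" by (cases "lo \<le> hi") auto
  have "hi - lo \<le> 1 / N' / \<Lambda>"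
    by (simp add: hi_def lo_def add_divide_distrib min_def max_def)
  hence "measure lborel {lo..hi} \<le> 1 / N' / \<Lambda>" using N' \<Lambda> unfolding mI by (simp add: max_def)
  hence "measure lborel S \<le> 1 / N' / \<Lambda>" using S_le by linarith
  hence "measure lborel S * N' \<le> 1 / N' / \<Lambda> * N'" using N' by (intro mult_right_mono) auto
  thus "(cmod (U i j))\<^sup>2 \<le> 1 / Lam p n b" using N' by (simp add: UB \<Lambda>_def)
  assume "U i j \<noteq> 0"
  hence "measure lborel S \<noteq> 0" using UB by auto
  hence "measure lborel S > 0" using measure_nonneg[of lborel S] by linarith
  hence "max 0 (hi - lo) > 0" using S_le unfolding mI by linarith
  hence lohi: "lo < hi" by (simp add: max_def split: if_splits)
  obtain L where L: "a = real L / N'"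
    using N_cyl_Nats[OF bW] dk by (auto simp: a_def N'_def)
  define M where "M = p ^ n b"
  have M: "\<Lambda> = real M" by (simp add: \<Lambda>_def M_def Lam_def)
  have 1: "j / N' < a + Suc i / N' / \<Lambda>" and 2: "a + i / N' / \<Lambda> < Suc j / N'"
    using lohi by (auto simp: lo_def hi_def)
  \<comment> \<open>After multiplication by \<open>N' * \<Lambda>\<close> both sides are integers,
    so strict inequality, which expresses overlap, improves by one unit to containment.\<close>
  from 1 have "real j * \<Lambda> < real L * \<Lambda> + Suc i" using N' \<Lambda> by (simp add: L field_simps)
  hence "real (j * M) < real (L * M + Suc i)" by (simp add: M)
  hence "j * M \<le> L * M + i" by (simp only: of_nat_less_iff)
  hence "real (j * M) \<le> real (L * M + i)" by (simp only: of_nat_le_iff)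
  hence 3: "real j * \<Lambda> \<le> real L * \<Lambda> + i" by (simp add: M)
  from 2 have "N' * \<Lambda> * (a + i / N' / \<Lambda>) < N' * \<Lambda> * (Suc j / N')"
    using N' \<Lambda> by (intro mult_strict_left_mono) auto
  moreover have "N' * \<Lambda> * (a + i / N' / \<Lambda>) = real L * \<Lambda> + i" using N' \<Lambda> by (simp add: L field_simps)
  moreover have "N' * \<Lambda> * (Suc j / N') = real (Suc j) * \<Lambda>" using N' by simp
  ultimately have "real L * \<Lambda> + i < real (Suc j) * \<Lambda>" by linarith
  hence "real (L * M + i) < real (Suc j * M)" by (simp add: M algebra_simps)
  hence "L * M + Suc i \<le> Suc j * M" by (simp only: of_nat_less_iff)
  hence "real (L * M + Suc i) \<le> real (Suc j * M)" by (simp only: of_nat_le_iff)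
  hence 4: "real L * \<Lambda> + Suc i \<le> real (Suc j) * \<Lambda>" by (simp add: M algebra_simps)
  have eq: "\<Lambda> * (x / N' - a) = (x * \<Lambda> - real L * \<Lambda>) / N'" for x
    by (simp add: L diff_divide_distrib algebra_simps)
  have "\<Lambda> * (j / N' - a) \<le> i / N'" unfolding eq using 3 N' by (intro divide_right_mono) auto
  moreover have "Suc i / N' \<le> \<Lambda> * (Suc j / N' - a)"
    unfolding eq using 4 N' by (intro divide_right_mono) auto
  ultimately show "Lam p n b * (gr j - lend p n b) \<le> gr i \<and> gr (Suc i) \<le> Lam p n b * (gr (Suc j) - lend p n b)"
    by (simp add: N'_def \<Lambda>_def a_def)
qed

text \<open>A nonzero entry puts cell \<open>i\<close> inside the image of cell \<open>j\<close>,
  and branch \<open>b\<close> maps the cylinder of \<open>b # e\<close> onto that of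
  \<open>e\<close>: one step of \<open>U\<close> shifts the word.\<close>

lemma U_cyl_step:
  assumes "i < N" "j < N" "b < l" "e \<in> W t" "Suc t * d \<le> k" "gr j \<in> cyl (b # e)" "U i j \<noteq> 0"
  shows "gr i \<in> cyl e"
proof -
  have be: "b # e \<in> W (Suc t)" using assms by simp
  have jb: "gr j \<in> cyl [b]" using cyl_ConsD assms by blast
  note entry = U_entry(2)[OF assms(1,2,3) jb assms(7)]
  have "cyl_left (b # e) \<le> gr j" using assms(6) by (simp add: cyl_def)
  hence "cyl_left e \<le> Lam p n b * (gr j - lend p n b)" by (simp add: field_simps)
  moreover have "gr (Suc j) \<le> cyl_right (b # e)" by (rule in_cyl_grid[OF be assms(5,6)])
  hence "Lam p n b * (gr (Suc j) - lend p n b) \<le> cyl_right e" by (simp add: cyl_right_Cons field_simps)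
  moreover have "gr i < gr (Suc i)" using N_pos by (simp add: divide_strict_right_mono)
  ultimately show ?thesis using entry by (simp add: cyl_def)
qed

text \<open>Branch \<open>b\<close> is injective, so the images of distinct cells share no interior
  and only one of them can contain cell \<open>i\<close>.\<close>

lemma U_row_unique:
  assumes "i < N" "j < N" "j' < N" "b < l" "gr j \<in> cyl [b]" "gr j' \<in> cyl [b]" "U i j \<noteq> 0" "U i j' \<noteq> 0"
  shows "j = j'"
proof -
  have less: "j < Suc j'" if "Lam p n b * (gr j - lend p n b) \<le> gr i" "gr (Suc i) \<le> Lam p n b * (gr (Suc j') - lend p n b)" for j j'
  proof -
    have "gr i < gr (Suc i)" using N_pos by (simp add: divide_strict_right_mono)
    hence "Lam p n b * (gr j - lend p n b) < Lam p n b * (gr (Suc j') - lend p n b)" using that by linarith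
    hence "gr j < gr (Suc j')" by simp
    thus ?thesis by (simp only: gr_less_iff)
  qed
  show ?thesis using less[of j j'] less[of j' j] U_entry(2)[OF assms(1,2,4,5,7)] U_entry(2)[OF assms(1,3,4,6,8)] by auto
qed

text \<open>Powers of \<open>U\<close> with the new factor on the right: a column index passes first
  through \<open>U\<close>, which removes the first letter of its cylinder, so induction on
  \<open>t\<close> follows the recursion on words.\<close>

fun V :: "nat \<Rightarrow> nat \<Rightarrow> nat \<Rightarrow> complex" where
  "V 0 i j = (if i = j then 1 else 0)"
| "V (Suc t) i j = (\<Sum>m<N. V t i m * U m j)"

lemma V_orth: "i < N \<Longrightarrow> j < N \<Longrightarrow> (\<Sum>m<N. cnj (V t m i) * V t m j) = (if i = j then 1 else 0)"
proof (induction t arbitrary: i j)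
  case 0
  have "cnj (V 0 m i) * V 0 m j = (if m = i then (if i = j then 1 else 0) else 0)" for m by simp
  thus ?case using 0 by simp
next
  case (Suc t)
  have "(\<Sum>m<N. cnj (V (Suc t) m i) * V (Suc t) m j) =
    (\<Sum>m<N. \<Sum>a<N. \<Sum>b<N. cnj (U a i) * U b j * (cnj (V t m a) * V t m b))"
    by (simp only: V.simps cnj_sum sum_product complex_cnj_mult) (simp only: mult_ac)
  also have "\<dots> = (\<Sum>a<N. \<Sum>b<N. \<Sum>m<N. cnj (U a i) * U b j * (cnj (V t m a) * V t m b))"
    by (subst sum.swap, rule sum.cong[OF refl], rule sum.swap)
  also have "\<dots> = (\<Sum>a<N. \<Sum>b<N. cnj (U a i) * U b j * (if a = b then 1 else 0))"
    by (simp add: Suc.IH flip: sum_distrib_left)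
  also have "\<dots> = (if i = j then 1 else 0)" using U_orth[OF Suc.prems] by (simp add: if_distrib cong: if_cong)
  finally show ?case .
qed

definition eigenval :: complex where
  "eigenval = (SOME c. \<forall>i<N. (\<Sum>j<N. U i j * \<psi> j) = c * \<psi> i)"

lemma U_eig: "i < N \<Longrightarrow> (\<Sum>j<N. U i j * \<psi> j) = eigenval * \<psi> i"
proof -
  have "\<exists>c. \<forall>i<N. (\<Sum>j<N. U i j * \<psi> j) = c * \<psi> i" using eigv by (simp add: normalized_eigenvector_def)
  from someI_ex[OF this] show "i < N \<Longrightarrow> ?thesis" by (simp add: eigenval_def)
qed

lemma psi_norm: "(\<Sum>i<N. (cmod (\<psi> i))\<^sup>2) = 1"
  using eigv by (simp add: normalized_eigenvector_def)

lemma U_iso: "(\<Sum>i<N. (cmod (\<Sum>j<N. U i j * v j))\<^sup>2) = (\<Sum>j<N. (cmod (v j))\<^sup>2)"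
  by (rule orthonormal_columns_isometry) (auto simp: U_orth)

lemma cmod_eigenval: "cmod eigenval = 1"
proof -
  have "(\<Sum>i<N. (cmod (eigenval * \<psi> i))\<^sup>2) = 1" using U_iso[of \<psi>] by (simp add: U_eig psi_norm)
  hence "(cmod eigenval)\<^sup>2 = 1" by (simp add: norm_mult power_mult_distrib psi_norm flip: sum_distrib_left)
  thus ?thesis using norm_ge_zero[of eigenval] power2_eq_1_iff[of "cmod eigenval"] by linarith
qed

lemma V_eig: "i < N \<Longrightarrow> (\<Sum>j<N. V t i j * \<psi> j) = eigenval ^ t * \<psi> i"
proof (induction t)
  case 0
  thus ?case by (simp add: mult_delta_left)
next
  case (Suc t)
  have "(\<Sum>j<N. V (Suc t) i j * \<psi> j) = (\<Sum>j<N. \<Sum>m<N. V t i m * (U m j * \<psi> j))"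
    by (simp add: sum_distrib_right mult.assoc)
  also have "\<dots> = (\<Sum>m<N. V t i m * (\<Sum>j<N. U m j * \<psi> j))"
    by (subst sum.swap) (simp add: sum_distrib_left)
  also have "\<dots> = (\<Sum>m<N. eigenval * (V t i m * \<psi> m))" by (intro sum.cong refl) (simp add: U_eig mult.left_commute)
  also have "\<dots> = eigenval * (eigenval ^ t * \<psi> i)" using Suc by (simp flip: sum_distrib_left)
  finally show ?case by simp
qed

lemma V_Suc_nonzero: "V (Suc t) i j \<noteq> 0 \<Longrightarrow> \<exists>m<N. V t i m \<noteq> 0 \<and> U m j \<noteq> 0"
proof (rule ccontr)
  assume "V (Suc t) i j \<noteq> 0" "\<not> ?thesis"
  hence "(\<Sum>m<N. V t i m * U m j) = 0" by (intro sum.neutral) auto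
  thus False using \<open>V (Suc t) i j \<noteq> 0\<close> by simp
qed

text \<open>A nonzero entry passes through an intermediate cell \<open>m\<close> in the cylinder of
  the shifted word. The induction hypothesis makes \<open>m\<close> unique, and injectivity of the
  first branch makes \<open>j\<close> unique.\<close>

lemma V_row_unique:
  assumes "i < N" "j < N" "j' < N" "e \<in> W t" "t * d \<le> k" "gr j \<in> cyl e" "gr j' \<in> cyl e"
    "V t i j \<noteq> 0" "V t i j' \<noteq> 0"
  shows "j = j'"
  using assms
proof (induction t arbitrary: j j' e)
  case 0
  thus ?case by (auto split: if_splits)
next
  case (Suc t)
  obtain b f where e: "e = b # f" "b < l" "f \<in> W t" using Suc.prems by (auto simp: words_Suc)
  have td: "t * d \<le> k" using Suc.prems by simp
  obtain m where m: "m < N" "V t i m \<noteq> 0" "U m j \<noteq> 0" using V_Suc_nonzero Suc.prems by blast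
  obtain m' where m': "m' < N" "V t i m' \<noteq> 0" "U m' j' \<noteq> 0" using V_Suc_nonzero Suc.prems by blast
  have "gr m \<in> cyl f" using U_cyl_step[OF m(1) Suc.prems(2) e(2,3) Suc.prems(5) _ m(3)] Suc.prems e by simp
  moreover have "gr m' \<in> cyl f" using U_cyl_step[OF m'(1) Suc.prems(3) e(2,3) Suc.prems(5) _ m'(3)] Suc.prems e by simp
  ultimately have "m = m'" using Suc.IH[OF Suc.prems(1) m(1) m'(1) e(3) td] m m' by blast
  moreover have "gr j \<in> cyl [b]" "gr j' \<in> cyl [b]" using Suc.prems e cyl_ConsD by blast+
  ultimately show ?case using U_row_unique[OF m(1) Suc.prems(2,3) e(2)] m m' by blast
qed

text \<open>Only one intermediate index contributes to the matrix product, so there is no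
  interference: the moduli multiply along the word, as the slopes do.\<close>

lemma V_bound:
  assumes "i < N" "j < N" "e \<in> W t" "t * d \<le> k" "gr j \<in> cyl e"
  shows "(cmod (V t i j))\<^sup>2 \<le> 1 / cyl_slope e"
  using assms
proof (induction t arbitrary: j e)
  case 0
  thus ?case by simp
next
  case (Suc t)
  obtain b f where e: "e = b # f" "b < l" "f \<in> W t" using Suc.prems by (auto simp: words_Suc)
  have td: "t * d \<le> k" using Suc.prems by simp
  show ?case
  proof (cases "V (Suc t) i j = 0")
    case True
    thus ?thesis by (simp only: True) (simp add: order.strict_implies_order[OF cyl_slope_pos])
  next
    case False
    then obtain m where m: "m < N" "V t i m \<noteq> 0" "U m j \<noteq> 0" using V_Suc_nonzero by blast
    have step: "gr m' \<in> cyl f" if "m' < N" "U m' j \<noteq> 0" for m'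
      using U_cyl_step[OF that(1) Suc.prems(2) e(2,3) Suc.prems(4) _ that(2)] Suc.prems e by simp
    have "V (Suc t) i j = (\<Sum>m'\<in>{m}. V t i m' * U m' j)"
      unfolding V.simps
    proof (rule sum.mono_neutral_right)
      show "\<forall>m'\<in>{..<N} - {m}. V t i m' * U m' j = 0"
      proof
        fix m' assume m': "m' \<in> {..<N} - {m}"
        show "V t i m' * U m' j = 0"
        proof (rule ccontr)
          assume "V t i m' * U m' j \<noteq> 0"
          hence "V t i m' \<noteq> 0" "U m' j \<noteq> 0" by auto
          thus False using V_row_unique[OF Suc.prems(1) m(1) _ e(3) td, of m'] m m' step by auto
        qed
      qed
    qed (use m in auto)
    hence "(cmod (V (Suc t) i j))\<^sup>2 = (cmod (V t i m))\<^sup>2 * (cmod (U m j))\<^sup>2"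
      by (simp add: norm_mult power_mult_distrib)
    also have "\<dots> \<le> 1 / cyl_slope f * (1 / Lam p n b)"
      using Suc.IH[OF Suc.prems(1) m(1) e(3) td step[OF m(1,3)]]
        U_entry(1)[OF m(1) Suc.prems(2) e(2)] cyl_ConsD Suc.prems e
      by (intro mult_mono) (auto simp: order.strict_implies_order[OF cyl_slope_pos])
    finally show ?thesis using e by (simp add: mult.commute)
  qed
qed

section \<open>Cylinder weights of the eigenvector\<close>

definition Q :: "nat list \<Rightarrow> real" where
  "Q e = (\<Sum>j\<in>{j. j < N \<and> gr j \<in> cyl e}. (cmod (\<psi> j))\<^sup>2)"

text \<open>\<open>A'\<close> collects the cells in the preimage of the cylinder of
  \<open>e\<close>. \<open>U\<close> maps the restriction of \<open>\<psi>\<close> to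
  \<open>A'\<close> exactly to \<open>eigenval\<close> times its restriction to that cylinder, and
  an isometry preserves the norm.\<close>

lemma Q_Cons_eq:
  assumes "e \<in> W t" "Suc t * d \<le> k"
  shows "(\<Sum>b<l. Q (b # e)) = Q e"
proof -
  define A' where "A' = {j. j < N \<and> (\<exists>b<l. gr j \<in> cyl (b # e))}"
  define v where "v = (\<lambda>j. if j \<in> A' then \<psi> j else 0)"
  have split: "(\<Sum>b<l. Q (b # e)) = (\<Sum>j\<in>A'. (cmod (\<psi> j))\<^sup>2)"
  proof -
    have "A' = (\<Union>b<l. {j. j < N \<and> gr j \<in> cyl (b # e)})" by (auto simp: A'_def)
    moreover have "(\<Sum>j\<in>(\<Union>b<l. {j. j < N \<and> gr j \<in> cyl (b # e)}). (cmod (\<psi> j))\<^sup>2) = (\<Sum>b<l. Q (b # e))"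
      unfolding Q_def using cyl_ConsD[OF _ assms(1)] cyl_single_disjoint
      by (intro sum.UNION_disjoint ballI impI) (simp, simp, blast)
    ultimately show ?thesis by simp
  qed
  have in_A': "j \<in> A'" if ij: "i < N" "j < N" "U i j \<noteq> 0" "gr i \<in> cyl e" for i j
  proof -
    obtain f where f: "f \<in> W (Suc t)" "gr j \<in> cyl f" using cyl_exists[of "gr j" "Suc t"] ij by auto
    obtain b g where g: "f = b # g" "b < l" "g \<in> W t" using f by (auto simp: words_Suc)
    have "gr i \<in> cyl g" using U_cyl_step[OF ij(1,2) g(2,3) assms(2) _ ij(3)] f g by simp
    hence "g = e" using cyl_disjoint ij(4) g(3) assms(1) by blast
    thus ?thesis using f g ij by (auto simp: A'_def)
  qed
  have Uv: "(\<Sum>j<N. U i j * v j) = (if gr i \<in> cyl e then eigenval * \<psi> i else 0)" if i: "i < N" for i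
  proof (cases "gr i \<in> cyl e")
    case True
    hence "(\<Sum>j<N. U i j * v j) = (\<Sum>j<N. U i j * \<psi> j)"
      using in_A'[OF i _ _ True] by (intro sum.cong) (auto simp: v_def)
    thus ?thesis using True U_eig[OF i] by simp
  next
    case False
    have "U i j * v j = 0" if "j < N" for j
      using U_cyl_step[OF i that _ assms] False by (auto simp: v_def A'_def)
    hence "(\<Sum>j<N. U i j * v j) = 0" by (intro sum.neutral) auto
    thus ?thesis using False by simp
  qed
  have "Q e = (\<Sum>i<N. if gr i \<in> cyl e then (cmod (\<psi> i))\<^sup>2 else 0)"
    unfolding Q_def by (simp add: sum.If_cases Collect_conj_eq lessThan_def)
  also have "\<dots> = (\<Sum>i<N. (cmod (\<Sum>j<N. U i j * v j))\<^sup>2)"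
    by (intro sum.cong) (auto simp: Uv norm_mult cmod_eigenval)
  also have "\<dots> = (\<Sum>j<N. (cmod (v j))\<^sup>2)" by (rule U_iso)
  also have "\<dots> = (\<Sum>j\<in>A'. (cmod (\<psi> j))\<^sup>2)"
    by (rule sum.mono_neutral_cong_right) (auto simp: A'_def v_def)
  finally show ?thesis using split by simp
qed

text \<open>\<open>k div d\<close> is the largest \<open>t\<close> with \<open>t * d <= k\<close>,
  the range in which cylinders are unions of cells. Appending a letter refines the cylinder;
  prepending one uses the eigenvector equation through \<open>Q_Cons_eq\<close>.\<close>

sublocale stationary_words "{..<l}" Q "k div d"
proof
  show "finite {..<l}" by simp
  show "Q e \<ge> 0" for e unfolding Q_def by (intro sum_nonneg) auto
  have "{j. j < N \<and> gr j \<in> cyl []} = {..<N}" by (auto simp: cyl_Nil)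
  thus "Q [] = 1" by (simp add: Q_def psi_norm)
  show "(\<Sum>b<l. Q (e @ [b])) = Q e" if "e \<in> W (length e)" for e
  proof -
    have "x \<in> cyl e \<longleftrightarrow> (\<exists>b<l. x \<in> cyl (e @ [b]))" for x
      using cyl_snoc_exists[of x e] cyl_appendD[of x e "[_]" 1] by (auto simp: words_def)
    hence "{j. j < N \<and> gr j \<in> cyl e} = (\<Union>b<l. {j. j < N \<and> gr j \<in> cyl (e @ [b])})"
      by auto
    moreover have "(\<Sum>j\<in>(\<Union>b<l. {j. j < N \<and> gr j \<in> cyl (e @ [b])}). (cmod (\<psi> j))\<^sup>2) = (\<Sum>b<l. Q (e @ [b]))"
      unfolding Q_def using cyl_snoc_disjoint by (intro sum.UNION_disjoint ballI impI) (simp, simp, blast)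
    ultimately show ?thesis by (simp add: Q_def)
  qed
  show "(\<Sum>b<l. Q (b # e)) = Q e" if "e \<in> W (length e)" "length e < k div d" for e
  proof (rule Q_Cons_eq[OF that(1)])
    show "Suc (length e) * d \<le> k" using that(2) d1
      by (metis Suc_leI div_le_mono less_eq_div_iff_mult_less_eq less_le_trans zero_less_one)
  qed
qed

text \<open>The uncertainty principle for \<open>V T\<close>, with cells classed by their words of
  length \<open>T\<close> and \<open>ln N = k * ln p\<close>. Stationarity turns the mean of
  \<open>ln (cyl_slope e)\<close> into \<open>T\<close> times a one-letter mean.\<close>

lemma entropy_lower_bound:
  "entropy_at (k div d) \<ge> real (k div d) * (\<Sum>b<l. Q [b] * ln (Lam p n b)) - real k * ln (real p) / 2"
proof -
  define T where "T = k div d"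
  have Td: "T * d \<le> k" by (simp add: T_def)
  define w where "w = (\<lambda>j. code T (gr j))"
  have wW: "w j \<in> W T" if "j < N" for j using that by (simp add: w_def code_in_words del: of_nat_power)
  have cw: "w j = e \<longleftrightarrow> gr j \<in> cyl e" if "j < N" "e \<in> W T" for j e
    unfolding w_def by (rule code_eq_iff) (use that in auto)
  have cw': "gr j \<in> cyl (w j)" if "j < N" for j using cw[OF that wW[OF that]] by simp
  define q where "q = (\<lambda>e. \<Sum>i\<in>{i\<in>{..<N}. w i = e}. (cmod (\<psi> i))\<^sup>2)"
  have qQ: "q e = Q e" if "e \<in> W T" for e
    unfolding q_def Q_def by (rule sum.cong) (use cw that in auto)
  have unc: "(\<Sum>e\<in>w ` {..<N}. q e * ln (q e)) + (\<Sum>e\<in>w ` {..<N}. q e * ln (cyl_slope e)) \<le> ln (real (card {..<N})) / 2"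
  proof (rule entropic_uncertainty[where V = "V T" and \<psi> = \<psi> and w = w and q = q])
    show "(\<Sum>i\<in>{..<N}. cnj (V T i j) * V T i j') = (if j = j' then 1 else 0)" if "j \<in> {..<N}" "j' \<in> {..<N}" for j j'
      using that by (simp add: V_orth)
    show "(\<Sum>j\<in>{..<N}. V T i j * \<psi> j) = eigenval ^ T * \<psi> i" if "i \<in> {..<N}" for i
      using that by (simp add: V_eig)
    show "(cmod (V T i j))\<^sup>2 \<le> 1 / cyl_slope (w j)" if "i \<in> {..<N}" "j \<in> {..<N}" for i j
      using that by (intro V_bound wW Td cw') auto
    show "j = j'" if "i \<in> {..<N}" "j \<in> {..<N}" "j' \<in> {..<N}" "w j = w j'" "V T i j \<noteq> 0" "V T i j' \<noteq> 0" for i j j'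
      using that cw'[of j] cw'[of j'] wW[of j] by (intro V_row_unique[of i j j' "w j" T] Td) auto
  qed (auto simp: psi_norm q_def)
  have ext: "(\<Sum>e\<in>w ` {..<N}. q e * f e) = (\<Sum>e\<in>W T. Q e * f e)" for f :: "nat list \<Rightarrow> real"
  proof (rule sum.mono_neutral_cong_left)
    show "\<forall>e\<in>W T - w ` {..<N}. Q e * f e = 0"
    proof
      fix e assume e: "e \<in> W T - w ` {..<N}"
      hence "{j. j < N \<and> gr j \<in> cyl e} = {}" using cw[of _ e] by auto
      thus "Q e * f e = 0" by (simp only: Q_def) simp
    qed
  qed (use wW qQ in auto)
  have "(\<Sum>e\<in>w ` {..<N}. q e * ln (q e)) = (\<Sum>e\<in>w ` {..<N}. q e * ln (Q e))"
    using wW by (intro sum.cong) (auto simp: qQ)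
  hence "- entropy_at T + (\<Sum>e\<in>W T. Q e * (\<Sum>b\<leftarrow>e. ln (Lam p n b))) \<le> ln (real N) / 2"
    using unc by (simp add: ext entropy_at_def ln_cyl_slope del: of_nat_power)
  moreover have "(\<Sum>e\<in>W T. Q e * (\<Sum>b\<leftarrow>e. ln (Lam p n b))) = real T * (\<Sum>b<l. Q [b] * ln (Lam p n b))"
    by (rule sum_additive) (simp add: T_def)
  moreover have "ln (real N) = real k * ln (real p)" using p2 by (simp add: ln_realpow)
  ultimately show ?thesis by (simp add: T_def)
qed

end

section \<open>Passage to the limit\<close>

text \<open>The open half of the portmanteau theorem: continuous functions \<open>f j\<close>
  increase to the indicator of \<open>G\<close>; the limit in \<open>i\<close> is taken first, then
  the limit in \<open>j\<close>. \<open>G \<noteq> UNIV\<close> keeps the complement nonempty, so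
  that \<open>infdist\<close> is a genuine distance.\<close>

lemma weak_conv_open_le:
  assumes \<nu>: "\<And>i. real_distribution (\<nu> i)" and \<mu>: "real_distribution \<mu>"
    and conv: "weak_conv_m \<nu> \<mu>" and G: "open G" "G \<noteq> UNIV"
    and le: "eventually (\<lambda>i. measure (\<nu> i) G \<le> c) sequentially"
  shows "measure \<mu> G \<le> c"
proof -
  interpret \<mu>: real_distribution \<mu> by fact
  define f where "f = (\<lambda>(j::nat) x::real. min 1 (real j * infdist x (- G)))"
  have f0: "f j x = 0" if "x \<notin> G" for j x using that by (simp add: f_def)
  have f_le: "0 \<le> f j x" "f j x \<le> 1" for j x by (auto simp: f_def infdist_nonneg)
  have ind: "f j x \<le> indicator G x" for j x using f0[of x j] f_le[of j x] by (auto simp: indicator_def)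
  have cont: "isCont (f j) x" for j x unfolding f_def by (intro continuous_intros)
  have meas [measurable]: "f j \<in> borel_measurable borel" for j
    by (intro borel_measurable_continuous_onI continuous_at_imp_continuous_on) (simp add: cont)
  have Gm [measurable]: "G \<in> sets borel" using G by simp
  have int_le: "integral\<^sup>L \<mu> (f j) \<le> c" for j
  proof (rule tendsto_upperbound)
    show "(\<lambda>i. integral\<^sup>L (\<nu> i) (f j)) \<longlonglongrightarrow> integral\<^sup>L \<mu> (f j)"
      by (rule weak_conv_imp_integral_bdd_continuous_conv[OF \<nu> \<mu> conv cont, where B = 1])
        (use f_le[of j] in auto)
    show "eventually (\<lambda>i. integral\<^sup>L (\<nu> i) (f j) \<le> c) sequentially"
      using le
    proof eventually_elim
      case (elim i)
      interpret \<nu>: real_distribution "\<nu> i" by (rule \<nu>)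
      have "integral\<^sup>L (\<nu> i) (f j) \<le> integral\<^sup>L (\<nu> i) (indicator G)"
        by (intro integral_mono ind \<nu>.integrable_const_bound[where B = 1]) (use f_le[of j] in auto)
      thus ?case using elim by simp
    qed
  qed simp
  have "(\<lambda>j. integral\<^sup>L \<mu> (f j)) \<longlonglongrightarrow> integral\<^sup>L \<mu> (indicator G)"
  proof (rule integral_dominated_convergence[where w = "\<lambda>_. 1"])
    show "AE x in \<mu>. (\<lambda>j. f j x) \<longlonglongrightarrow> indicator G x"
    proof (rule AE_I2)
      fix x
      show "(\<lambda>j. f j x) \<longlonglongrightarrow> indicator G x"
      proof (cases "x \<in> G")
        case True
        have "infdist x (- G) > 0"
          using True G by (intro infdist_pos_not_in_closed) auto
        then obtain j0 where j0: "1 < real j0 * infdist x (- G)"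
          using reals_Archimedean3 by blast
        have "f j x = 1" if "j \<ge> j0" for j
        proof -
          have "real j0 * infdist x (- G) \<le> real j * infdist x (- G)"
            using that by (intro mult_right_mono infdist_nonneg) auto
          thus ?thesis using j0 by (simp add: f_def)
        qed
        thus ?thesis using True
          by (intro tendsto_eventually) (auto simp: eventually_sequentially)
      qed (simp add: f0)
    qed
  qed (use f_le in auto)
  hence "(\<lambda>j. integral\<^sup>L \<mu> (f j)) \<longlonglongrightarrow> measure \<mu> G" by simp
  thus ?thesis by (rule LIMSEQ_le_const2) (use int_le in blast)
qed

text \<open>Continuity of \<open>ln\<close> settles \<open>a \<noteq> 0\<close>. Limit weights may
  vanish, and at \<open>a = 0\<close> the estimate \<open>|y * ln y| <= 2 * sqrt y\<close> takes
  over.\<close>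

lemma tendsto_mult_ln_self:
  fixes f :: "'a \<Rightarrow> real"
  assumes f: "(f \<longlongrightarrow> a) F" and f0: "\<And>x. f x \<ge> 0"
  shows "((\<lambda>x. f x * ln (f x)) \<longlongrightarrow> a * ln a) F"
proof (cases "a = 0")
  case False
  thus ?thesis by (intro tendsto_intros f)
next
  case True
  have bound: "\<bar>y * ln y\<bar> \<le> 2 * sqrt y" if y: "0 \<le> y" "y \<le> 1" for y :: real
  proof (cases "y = 0")
    case False
    hence y0: "y > 0" using y by simp
    have "ln (1 / sqrt y) \<le> 1 / sqrt y - 1" using y0 by (intro ln_le_minus_one) auto
    hence "- ln y \<le> 2 / sqrt y" using y0 by (simp add: ln_div ln_sqrt)
    hence "y * (- ln y) \<le> y * (2 / sqrt y)" using y0 by (intro mult_left_mono) auto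
    also have "\<dots> = 2 * (y / sqrt y)" by simp
    also have "\<dots> = 2 * sqrt y" using y0 by (simp only: real_div_sqrt)
    finally show ?thesis using y0 y by (simp add: abs_mult)
  qed simp
  have "eventually (\<lambda>x. f x < 1) F" using order_tendstoD(2)[OF f, of 1] True by simp
  hence "eventually (\<lambda>x. norm (f x * ln (f x)) \<le> 2 * sqrt (f x)) F"
    by eventually_elim (use bound f0 in auto)
  moreover have "((\<lambda>x. 2 * sqrt (f x)) \<longlongrightarrow> 2 * sqrt 0) F" using f True by (intro tendsto_intros) auto
  ultimately have "((\<lambda>x. f x * ln (f x)) \<longlongrightarrow> 0) F"
    by (simp add: Lim_null_comparison)
  thus ?thesis using True by simp
qed

section \<open>Extended cylinders and their frontiers\<close>

context power_slopes
begin

lemma cyl_right_eq_1_iff: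
  assumes "e \<in> W t"
  shows "cyl_right e = 1 \<longleftrightarrow> set e \<subseteq> {l - 1}"
  using assms
proof (induction t arbitrary: e)
  case (Suc t)
  obtain b f where e: "e = b # f" "b < l" "f \<in> W t" using Suc.prems by (auto simp: words_Suc)
  have last: "lend p n (l - 1) + 1 / Lam p n (l - 1) = 1" using cyl_right_last by (simp add: cyl_right_Cons)
  show ?case
  proof (cases "b = l - 1")
    case True
    have "cyl_right e = 1 \<longleftrightarrow> lend p n b + cyl_right f / Lam p n b = lend p n b + 1 / Lam p n b"
      unfolding e(1) cyl_right_Cons True last ..
    thus ?thesis using Suc.IH[OF e(3)] e True by simp
  next
    case False
    have "lend p n b + cyl_right f / Lam p n b \<le> lend p n (Suc b)"
      using cyl_bounds[OF e(3)] by (simp add: lend_Suc divide_right_mono order.strict_implies_order[OF lam_pos])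
    also have "\<dots> < lend p n (Suc (Suc b))" using lend_Suc[of "Suc b"] by simp
    also have "\<dots> \<le> 1" using lend_mono[of "Suc (Suc b)" l] False e by simp
    finally show ?thesis using False e by (auto simp: cyl_right_Cons)
  qed
qed simp

text \<open>Cylinders at the ends of the unit interval are enlarged to half-lines, so that \<open>0\<close> and \<open>1\<close>,
  which a limit measure may charge, are not boundary points.\<close>

definition ext_cyl :: "nat list \<Rightarrow> real set" where
  "ext_cyl e = {x. (cyl_left e = 0 \<or> cyl_left e \<le> x) \<and> (cyl_right e = 1 \<or> x < cyl_right e)}"

lemma ext_cyl_borel [measurable]: "ext_cyl e \<in> sets borel"
  unfolding ext_cyl_def by measurable

lemma ext_cyl_Int: "e \<in> W t \<Longrightarrow> ext_cyl e \<inter> {0..1} = ccyl e"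
  using cyl_bounds[of e t] cyl_right_eq_1_iff[of e t] cyl_left_less_right[of e]
  by (auto simp: ext_cyl_def ccyl_def cyl_def)

lemma ext_cyl_Int': "e \<in> W t \<Longrightarrow> ext_cyl e \<inter> {0..<1} = cyl e"
  using cyl_bounds[of e t] by (auto simp: ext_cyl_def cyl_def)

text \<open>Weak inequalities give a closed superset \<open>C\<close>, strict ones an open subset
  \<open>D\<close>; the two differ at most in a left end other than 0 and a right end other than
  1.\<close>

lemma frontier_ext_cyl:
  "frontier (ext_cyl e) \<subseteq> (if cyl_left e = 0 then {} else {cyl_left e}) \<union> (if cyl_right e = 1 then {} else {cyl_right e})"
proof -
  define C where "C = {x. (cyl_left e = 0 \<or> cyl_left e \<le> x) \<and> (cyl_right e = 1 \<or> x \<le> cyl_right e)}"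
  define D where "D = {x. (cyl_left e = 0 \<or> cyl_left e < x) \<and> (cyl_right e = 1 \<or> x < cyl_right e)}"
  have "closed C" unfolding C_def by (intro closed_Collect_conj closed_Collect_disj closed_Collect_const closed_Collect_le continuous_intros)
  hence "closure (ext_cyl e) \<subseteq> C" by (intro closure_minimal) (auto simp: ext_cyl_def C_def)
  moreover have "open D" unfolding D_def by (intro open_Collect_conj open_Collect_disj open_Collect_const open_Collect_less continuous_intros)
  hence "D \<subseteq> interior (ext_cyl e)" by (intro interior_maximal) (auto simp: ext_cyl_def D_def)
  ultimately have "frontier (ext_cyl e) \<subseteq> C - D" unfolding frontier_def by blast
  also have "\<dots> \<subseteq> (if cyl_left e = 0 then {} else {cyl_left e}) \<union> (if cyl_right e = 1 then {} else {cyl_right e})"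
    by (auto simp: C_def D_def)
  finally show ?thesis .
qed

end

section \<open>Semiclassical measures of cylinders\<close>

context quantized
begin

abbreviation "S \<equiv> semiclassical_measure N \<psi>"

lemma emeasure_semiclassical:
  assumes [measurable]: "A \<in> sets borel"
  shows "emeasure S A = (\<Sum>i<N. ennreal ((cmod (\<psi> i))\<^sup>2 * real N) * emeasure lborel (Ecell N i \<inter> A))"
proof -
  have E [measurable]: "Ecell N i \<in> sets borel" for i by (simp add: Ecell_def)
  have "(\<lambda>x. ennreal (\<Sum>i<N. (cmod (\<psi> i))\<^sup>2 * real N * indicator (Ecell N i) x)) \<in> borel_measurable lborel"
    by (intro measurable_compose[OF _ measurable_ennreal] borel_measurable_sum borel_measurable_times
      borel_measurable_const borel_measurable_indicator) (simp add: E)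
  hence "emeasure S A = (\<integral>\<^sup>+x. ennreal (\<Sum>i<N. (cmod (\<psi> i))\<^sup>2 * real N * indicator (Ecell N i) x) * indicator A x \<partial>lborel)"
    unfolding semiclassical_measure_def by (rule emeasure_density) simp
  also have "\<dots> = (\<integral>\<^sup>+x. (\<Sum>i<N. ennreal ((cmod (\<psi> i))\<^sup>2 * real N) * indicator (Ecell N i \<inter> A) x) \<partial>lborel)"
    by (intro nn_integral_cong) (auto simp: indicator_def sum_ennreal[symmetric] simp del: sum_ennreal of_nat_power intro!: sum.cong)
  also have "\<dots> = (\<Sum>i<N. ennreal ((cmod (\<psi> i))\<^sup>2 * real N) * emeasure lborel (Ecell N i \<inter> A))"
    by (subst nn_integral_sum) (auto simp: nn_integral_cmult_indicator)
  finally show ?thesis .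
qed

lemma emeasure_Ecell: "emeasure lborel (Ecell N i) = ennreal (1 / real N)"
  using N_pos unfolding Ecell_def
  by (subst emeasure_lborel_Icc) (auto simp: divide_right_mono add_divide_distrib simp del: of_nat_power)

lemma semiclassical_real_distribution: "real_distribution S"
proof -
  have "emeasure S UNIV = (\<Sum>i<N. ennreal ((cmod (\<psi> i))\<^sup>2 * real N) * ennreal (1 / real N))"
    by (simp add: emeasure_semiclassical emeasure_Ecell del: of_nat_power)
  also have "\<dots> = (\<Sum>i<N. ennreal ((cmod (\<psi> i))\<^sup>2))"
    using N_pos by (intro sum.cong refl) (simp add: ennreal_mult''[symmetric] del: of_nat_power)
  also have "\<dots> = 1" by (simp add: sum_ennreal psi_norm)
  finally have "emeasure S (space S) = 1" by (simp add: semiclassical_measure_def)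
  thus ?thesis
    by (intro real_distribution.intro prob_spaceI real_distribution_axioms.intro) (simp_all add: semiclassical_measure_def)
qed

lemma semiclassical_off_unit:
  assumes "A \<in> sets borel" "A \<inter> {0..<1} = {}"
  shows "measure S A = 0"
proof -
  have "emeasure lborel (Ecell N i \<inter> A) = 0" if "i < N" for i
  proof -
    have "real (Suc i) / real N \<le> 1" using that N_pos by (simp add: divide_le_eq del: of_nat_power)
    moreover have "0 \<le> real i / real N" by simp
    ultimately have "Ecell N i \<subseteq> {0..1}" unfolding Ecell_def by (auto simp del: of_nat_power)
    hence "Ecell N i \<inter> A \<subseteq> {1}" using assms(2) by force
    hence "emeasure lborel (Ecell N i \<inter> A) \<le> emeasure lborel {1 :: real}" by (intro emeasure_mono) auto
    thus ?thesis by simp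
  qed
  hence "emeasure S A = 0" using assms by (simp add: emeasure_semiclassical)
  thus ?thesis by (simp add: measure_def)
qed

lemma semiclassical_Int_unit:
  assumes "A \<in> sets borel"
  shows "measure S A = measure S (A \<inter> {0..<1})"
proof -
  interpret S: real_distribution S by (rule semiclassical_real_distribution)
  have "measure S A = measure S (A \<inter> {0..<1}) + measure S (A - {0..<1})"
    using assms by (subst S.finite_measure_Union[symmetric]) (auto intro!: arg_cong[where f = "measure S"])
  thus ?thesis using semiclassical_off_unit[of "A - {0..<1}"] assms by auto
qed

text \<open>A cell whose left end lies in the cylinder is inside it up to a null set; any other cell
  meets it at most in its right end. Each cell has mass \<open>(cmod (\<psi> i))^2\<close>.\<close>

lemma semiclassical_cyl:
  assumes e: "e \<in> W t" "t * d \<le> k"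
  shows "measure S (cyl e) = Q e"
proof -
  obtain a b where ab: "cyl_left e = real a / real N" "cyl_right e = real b / real N"
    using N_cyl_Nats[OF e] by blast
  have cyl: "x \<in> cyl e \<longleftrightarrow> gr a \<le> x \<and> x < gr b" for x by (simp only: cyl_def ab atLeastLessThan_iff)
  have "emeasure lborel (Ecell N i \<inter> cyl e) = (if gr i \<in> cyl e then ennreal (1 / real N) else 0)" for i
  proof (cases "gr i \<in> cyl e")
    case True
    hence "gr (Suc i) \<le> gr b" using in_cyl_grid[OF e] ab by simp
    hence "{gr i..<gr (Suc i)} \<subseteq> Ecell N i \<inter> cyl e" using True by (auto simp: cyl Ecell_def simp del: of_nat_power)
    hence "emeasure lborel {gr i..<gr (Suc i)} \<le> emeasure lborel (Ecell N i \<inter> cyl e)"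
      by (intro emeasure_mono) (auto simp: Ecell_def cyl_def)
    moreover have "emeasure lborel {gr i..<gr (Suc i)} = ennreal (1 / real N)"
      using N_pos by (subst emeasure_lborel_Ico) (auto simp: divide_right_mono add_divide_distrib simp del: of_nat_power)
    moreover have "emeasure lborel (Ecell N i \<inter> cyl e) \<le> emeasure lborel (Ecell N i)"
      by (intro emeasure_mono) (auto simp: Ecell_def)
    ultimately show ?thesis using True by (simp add: emeasure_Ecell del: of_nat_power)
  next
    case False
    have "x = gr (Suc i)" if x: "x \<in> Ecell N i" "x \<in> cyl e" for x
    proof (rule ccontr)
      assume "x \<noteq> gr (Suc i)"
      hence "gr i \<le> x" "x < gr (Suc i)" using x by (auto simp: Ecell_def simp del: of_nat_power)
      hence "gr i < gr b" "gr a < gr (Suc i)" using x by (auto simp: cyl simp del: of_nat_power)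
      hence "a \<le> i" "i < b" by (auto simp only: gr_less_iff)
      hence "gr i \<in> cyl e" by (simp only: cyl gr_le_iff gr_less_iff)
      thus False using False by simp
    qed
    hence "Ecell N i \<inter> cyl e \<subseteq> {gr (Suc i)}" by auto
    hence "emeasure lborel (Ecell N i \<inter> cyl e) \<le> emeasure lborel {gr (Suc i)}" by (intro emeasure_mono) auto
    thus ?thesis using False by simp
  qed
  hence "emeasure S (cyl e) = (\<Sum>i<N. ennreal ((cmod (\<psi> i))\<^sup>2 * real N) * (if gr i \<in> cyl e then ennreal (1 / real N) else 0))"
    by (subst emeasure_semiclassical) (auto simp: cyl_def simp del: of_nat_power)
  also have "\<dots> = (\<Sum>i<N. ennreal (if gr i \<in> cyl e then (cmod (\<psi> i))\<^sup>2 else 0))"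
    using N_pos by (intro sum.cong refl) (simp add: ennreal_mult''[symmetric] del: of_nat_power)
  also have "\<dots> = ennreal (\<Sum>i<N. if gr i \<in> cyl e then (cmod (\<psi> i))\<^sup>2 else 0)"
    by (rule sum_ennreal) simp
  also have "(\<Sum>i<N. if gr i \<in> cyl e then (cmod (\<psi> i))\<^sup>2 else 0) = Q e"
    unfolding Q_def by (simp add: sum.If_cases Collect_conj_eq lessThan_def)
  finally show ?thesis using Q0 by (simp add: measure_def)
qed

lemma semiclassical_ext_cyl: "e \<in> W t \<Longrightarrow> t * d \<le> k \<Longrightarrow> measure S (ext_cyl e) = Q e"
  using semiclassical_Int_unit[OF ext_cyl_borel] ext_cyl_Int' semiclassical_cyl by metis

text \<open>Two cylinders that meet at the junction cover the interval. Each word contains, after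
  \<open>u\<close>, a passage into a run of \<open>M\<close> equal letters, so
  \<open>Q_Cons_replicate_le\<close> bounds its weight by \<open>1 / M\<close>, whatever the level
  \<open>k\<close>.\<close>

lemma semiclassical_near_boundary:
  assumes u: "u @ [Suc b] \<in> W (Suc (length u))" and M: "M > 0" "(Suc (length u) + M) * d \<le> k"
  shows "measure S {cyl_left (u @ b # replicate M (l - 1)) <..< cyl_right (u @ Suc b # replicate M 0)} \<le> 2 / real M"
proof -
  interpret S: real_distribution S by (rule semiclassical_real_distribution)
  define e where "e = u @ Suc b # replicate M 0"
  define f where "f = u @ b # replicate M (l - 1)"
  have uW: "u \<in> W (length u)" and bl: "Suc b < l" using u by (auto simp: words_def)
  have e: "e \<in> W (Suc (length u) + M)" and f: "f \<in> W (Suc (length u) + M)"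
    using u l_pos by (auto simp: e_def f_def words_def)
  have mid: "cyl_right f = cyl_left e"
    using cyl_right_append_last[of "u @ [b]" M] cyl_left_append_0[of "u @ [Suc b]" M] cyl_right_snoc[of u b]
    by (simp add: e_def f_def)
  have T: "length u + Suc M \<le> k div d" "Suc M \<le> k div d"
    using M(2) d1 by (auto simp: less_eq_div_iff_mult_less_eq algebra_simps)
  have "real M * Q (Suc b # replicate M 0) \<le> 1" "real M * Q (b # replicate M (l - 1)) \<le> 1"
    using bl T by (auto intro!: Q_Cons_replicate_le)
  hence small: "Q (Suc b # replicate M 0) \<le> 1 / real M" "Q (b # replicate M (l - 1)) \<le> 1 / real M"
    using M by (auto simp: field_simps)
  have "Q e \<le> Q (Suc b # replicate M 0)" "Q f \<le> Q (b # replicate M (l - 1))"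
    unfolding e_def f_def using uW bl T by (auto intro!: Q_append_le[where s = "length u" and t = "Suc M"] simp: words_def)
  hence Qef: "Q e \<le> 1 / real M" "Q f \<le> 1 / real M" using small by auto
  have "measure S {cyl_left f <..< cyl_right e} \<le> measure S (cyl e \<union> cyl f)"
    using mid by (intro S.finite_measure_mono) (auto simp: cyl_def)
  also have "\<dots> \<le> measure S (cyl e) + measure S (cyl f)"
    by (rule measure_Un_le) (auto simp: cyl_def)
  also have "\<dots> = Q e + Q f" using semiclassical_cyl[OF e M(2)] semiclassical_cyl[OF f M(2)] by simp
  finally show ?thesis using Qef by (simp add: e_def f_def)
qed

text \<open>\<open>entropy_lower_bound\<close> against \<open>entropy_le_linear\<close>, divided by
  \<open>T = k div d\<close>. The term \<open>1 + 1 / T\<close> comes from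
  \<open>k <= (T + 1) * d\<close>.\<close>

lemma semiclassical_entropy_bound:
  assumes m: "0 < m" "m \<le> k div d"
  shows "(\<Sum>b<l. measure S (ext_cyl [b]) * ln (Lam p n b)) - (1 + 1 / real (k div d)) * (real d * ln (real p)) / 2
    \<le> - (\<Sum>e\<in>W m. measure S (ext_cyl e) * ln (measure S (ext_cyl e))) / real m + real (l ^ m) / real (k div d)"
proof -
  define T where "T = k div d"
  have T: "T > 0" "T \<ge> 1" using m by (auto simp: T_def)
  have md: "m * d \<le> k" using m(2) d1 by (simp add: less_eq_div_iff_mult_less_eq)
  have lnp: "ln (real p) \<ge> 0" using p2 by simp
  have "k \<le> Suc T * d" using d1 dividend_less_div_times[of d k] by (simp add: T_def)
  hence "real k \<le> real (Suc T * d)" by (rule of_nat_mono)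
  hence kT: "real k \<le> (real T + 1) * real d" by (simp add: algebra_simps)
  have Qb: "measure S (ext_cyl [b]) = Q [b]" if "b < l" for b
    using that dk by (intro semiclassical_ext_cyl[of _ 1]) (auto simp: words_def)
  have Qe: "measure S (ext_cyl e) = Q e" if "e \<in> W m" for e
    using that md by (rule semiclassical_ext_cyl)
  define L where "L = (\<Sum>b<l. Q [b] * ln (Lam p n b))"
  have "real T * L - real k * ln (real p) / 2 \<le> real T / real m * entropy_at m + real (l ^ m)"
    using entropy_lower_bound entropy_le_linear[OF m] by (simp add: T_def L_def)
  moreover have "real k * ln (real p) \<le> (real T + 1) * real d * ln (real p)"
    using kT lnp by (rule mult_right_mono)
  ultimately have "real T * L - (real T + 1) * real d * ln (real p) / 2 \<le> real T / real m * entropy_at m + real (l ^ m)"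
    by linarith
  hence "(real T * L - (real T + 1) * real d * ln (real p) / 2) / real T \<le> (real T / real m * entropy_at m + real (l ^ m)) / real T"
    by (rule divide_right_mono) simp
  hence "L - (1 + 1 / real T) * (real d * ln (real p)) / 2 \<le> entropy_at m / real m + real (l ^ m) / real T"
    using T by (simp add: add_divide_distrib diff_divide_distrib algebra_simps)
  thus ?thesis by (simp add: L_def entropy_at_def Qb Qe T_def)
qed

end

section \<open>The partition into branch intervals and its joins\<close>

context power_slopes
begin

lemma Iv_ccyl: "b < l \<Longrightarrow> Iv p l n b = ccyl [b]"
  by (auto simp: Iv_eq ccyl_def)

lemma ccyl_borel [measurable]: "ccyl e \<in> sets borel"
  by (simp add: ccyl_def cyl_def)

text \<open>The left end lies in only one cylinder of given length, so the set determines the word.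
  Entropy of a join, a sum over sets, can then be reindexed by words.\<close>

lemma inj_on_ccyl: "inj_on ccyl (W t)"
proof (rule inj_onI)
  fix e e' assume e: "e \<in> W t" "e' \<in> W t" "ccyl e = ccyl e'"
  have left: "cyl_left e \<in> cyl e" using cyl_left_less_right[of e] by (simp add: cyl_def)
  hence "cyl_left e < 1" using cyl_subset[OF e(1)] by auto
  moreover have "cyl_left e \<in> ccyl e'" using left e(3) unfolding ccyl_def by blast
  ultimately have "cyl_left e \<in> cyl e'" by (auto simp: ccyl_def split: if_splits)
  thus "e = e'" using left e cyl_disjoint by blast
qed

lemma is_partition_Iv: "is_partition (Iv p l n ` {..<l})"
  unfolding is_partition_def
proof (intro conjI ballI)
  fix A assume "A \<in> Iv p l n ` {..<l}"
  then obtain b where "b < l" "A = Iv p l n b" by auto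
  thus "A \<in> sets borel" "A \<subseteq> {0..1}" using Iv_cover by (auto simp: Iv_ccyl)
next
  show "disjoint (Iv p l n ` {..<l})" using Iv_disjoint by (fastforce simp: disjoint_def)
qed (use Iv_cover in auto)

lemma join_part_Iv: "join_part (Tp p l n) (Iv p l n ` {..<l}) m = ccyl ` W m"
proof -
  have it: "{0..1} \<inter> (\<Inter>i<m. (Tp p l n ^^ i) -` A i) = ccyl e"
    if "e \<in> W m" "\<And>i. i < m \<Longrightarrow> A i = Iv p l n (e ! i)" for e A
    using that(2) by (auto simp: ccyl_itinerary[OF that(1)])
  have nth: "e ! i < l" if "e \<in> W m" "i < m" for e i
    using that nth_mem[of i e] unfolding words_def by blast
  show ?thesis
  proof (intro subset_antisym subsetI)
    fix X assume "X \<in> join_part (Tp p l n) (Iv p l n ` {..<l}) m"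
    then obtain A where X: "X = {0..1} \<inter> (\<Inter>i<m. (Tp p l n ^^ i) -` A i)"
      and A: "\<forall>i<m. A i \<in> Iv p l n ` {..<l}" by (auto simp: join_part_def)
    then obtain f where f: "\<And>i. i < m \<Longrightarrow> f i < l \<and> A i = Iv p l n (f i)"
      by (simp add: image_iff Bex_def) metis
    have "X = ccyl (map f [0..<m])" unfolding X by (rule it) (use f in \<open>auto simp: words_def\<close>)
    moreover have "map f [0..<m] \<in> W m" using f by (auto simp: words_def)
    ultimately show "X \<in> ccyl ` W m" by blast
  next
    fix X assume "X \<in> ccyl ` W m"
    then obtain e where e: "e \<in> W m" "X = ccyl e" by blast
    hence "X = {0..1} \<inter> (\<Inter>i<m. (Tp p l n ^^ i) -` Iv p l n (e ! i))" using it by simp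
    thus "X \<in> join_part (Tp p l n) (Iv p l n ` {..<l}) m"
      unfolding join_part_def using nth[OF e(1)]
      by (intro CollectI exI[of _ "\<lambda>i. Iv p l n (e ! i)"]) auto
  qed
qed

lemma part_entropy_join_Iv:
  "part_entropy \<mu> (join_part (Tp p l n) (Iv p l n ` {..<l}) m) = - (\<Sum>e\<in>W m. measure \<mu> (ccyl e) * ln (measure \<mu> (ccyl e)))"
  by (simp add: part_entropy_def join_part_Iv sum.reindex[OF inj_on_ccyl])

end

text \<open>Convergence is asked along a subsequence \<open>r\<close>, so that every weak limit
  point of the semiclassical measures is covered.\<close>

locale semiclassical_limit = power_slopes +
  fixes U :: "nat \<Rightarrow> nat \<Rightarrow> nat \<Rightarrow> complex" and \<psi> :: "nat \<Rightarrow> nat \<Rightarrow> complex"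
    and r :: "nat \<Rightarrow> nat" and \<mu> :: "real measure"
  assumes quant: "\<And>k. quantization (Tp p l n) (p ^ k) (U k)"
    and eigv: "\<And>k. normalized_eigenvector (p ^ k) (U k) (\<psi> k)"
    and r: "strict_mono r"
    and \<mu>: "real_distribution \<mu>"
    and conv: "weak_conv_m (\<lambda>i. semiclassical_measure (p ^ r i) (\<psi> (r i))) \<mu>"
begin

definition d :: nat where "d = Max (n ` {..<l})"

lemma n_le_d: "b < l \<Longrightarrow> n b \<le> d"
  unfolding d_def by (intro Max_ge) auto

lemma d_pos: "d \<ge> 1"
  using n1[OF l_pos] n_le_d[OF l_pos] by linarith

lemma ln_Max_Lam: "ln (Max {Lam p n j | j. j < l}) = real d * ln (real p)"
proof -
  have "Max {Lam p n j | j. j < l} = real p ^ d"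
  proof (rule Max_eqI)
    have "d \<in> n ` {..<l}" unfolding d_def using l_pos by (intro Max_in) auto
    thus "real p ^ d \<in> {Lam p n j | j. j < l}" by (auto simp: Lam_def)
    show "y \<le> real p ^ d" if "y \<in> {Lam p n j | j. j < l}" for y
      using that p2 n_le_d by (auto simp: Lam_def intro!: power_increasing)
  qed simp
  thus ?thesis using p2 by (simp add: ln_realpow)
qed

text \<open>The shift by \<open>d\<close> makes every \<open>I\<^sub>j\<close> a union of cells.\<close>

definition lev :: "nat \<Rightarrow> nat" where "lev i = r (i + d)"

definition \<nu> :: "nat \<Rightarrow> real measure" where
  "\<nu> i = semiclassical_measure (p ^ lev i) (\<psi> (lev i))"

lemma lev_ge: "i + d \<le> lev i"
  unfolding lev_def by (rule seq_suble[OF r])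

lemma quantized_lev: "quantized p l n (lev i) d (U (lev i)) (\<psi> (lev i))"
proof
  show "d \<le> lev i" using lev_ge[of i] by linarith
qed (use quant eigv n_le_d d_pos in auto)

lemma \<nu>_real_distribution: "real_distribution (\<nu> i)"
  unfolding \<nu>_def by (rule quantized.semiclassical_real_distribution[OF quantized_lev])

lemma \<nu>_conv: "weak_conv_m \<nu> \<mu>"
  using conv unfolding weak_conv_m_def weak_conv_def \<nu>_def lev_def
  by (auto intro: LIMSEQ_ignore_initial_segment)

text \<open>An open interval around the point, depending on \<open>M\<close> but not on the level,
  has mass at most \<open>2 / M\<close> at all large levels. The bound passes to
  \<open>\<mu>\<close> because the interval is open, and \<open>M\<close> is arbitrary.\<close>

lemma boundary_null:
  assumes u: "u @ [b] \<in> W (Suc (length u))" and b: "b > 0"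
  shows "measure \<mu> {cyl_left (u @ [b])} = 0"
proof -
  interpret \<mu>: real_distribution \<mu> by (rule \<mu>)
  obtain a where a: "b = Suc a" using b by (cases b) auto
  have le: "measure \<mu> {cyl_left (u @ [b])} \<le> 2 / real M" if M: "M > 0" for M
  proof -
    define G where "G = {cyl_left (u @ a # replicate M (l - 1)) <..< cyl_right (u @ Suc a # replicate M 0)}"
    have x: "cyl_left (u @ [b]) \<in> G"
      using cyl_right_append_last[of "u @ [a]" M] cyl_left_append_0[of "u @ [Suc a]" M] cyl_right_snoc[of u a]
        cyl_left_less_right[of "u @ a # replicate M (l - 1)"] cyl_left_less_right[of "u @ Suc a # replicate M 0"]
      by (simp add: G_def a)
    have "measure \<mu> G \<le> 2 / real M"
    proof (rule weak_conv_open_le[OF \<nu>_real_distribution \<mu> \<nu>_conv])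
      show "open G" by (simp add: G_def)
      have "cyl_left (u @ a # replicate M (l - 1)) \<notin> G" by (simp add: G_def)
      thus "G \<noteq> UNIV" by blast
      show "eventually (\<lambda>i. measure (\<nu> i) G \<le> 2 / real M) sequentially"
        using eventually_ge_at_top[of "(Suc (length u) + M) * d"]
      proof eventually_elim
        case (elim i)
        show ?case unfolding G_def \<nu>_def
          by (rule quantized.semiclassical_near_boundary[OF quantized_lev _ M])
            (use u a elim lev_ge[of i] in auto)
      qed
    qed
    moreover have "measure \<mu> {cyl_left (u @ [b])} \<le> measure \<mu> G"
      using x by (intro \<mu>.finite_measure_mono) (auto simp: G_def)
    ultimately show ?thesis by linarith
  qed
  have "(\<lambda>M. 2 / real M) \<longlonglongrightarrow> 0" by (rule lim_const_over_n)
  hence "measure \<mu> {cyl_left (u @ [b])} \<le> 0"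
    by (rule LIMSEQ_le_const) (use le in \<open>auto intro!: exI[of _ 1]\<close>)
  thus ?thesis using measure_nonneg[of \<mu> "{cyl_left (u @ [b])}"] by linarith
qed

lemma \<mu>_off_unit: "measure \<mu> (- {0..1}) = 0"
proof -
  have "measure \<mu> (- {0..1}) \<le> 0"
  proof (rule weak_conv_open_le[OF \<nu>_real_distribution \<mu> \<nu>_conv])
    have "0 \<notin> - {0..1 :: real}" by simp
    thus "- {0..1} \<noteq> (UNIV :: real set)" by blast
    have "measure (\<nu> i) (- {0..1}) = 0" for i
      unfolding \<nu>_def by (rule quantized.semiclassical_off_unit[OF quantized_lev]) auto
    thus "eventually (\<lambda>i. measure (\<nu> i) (- {0..1}) \<le> 0) sequentially" by simp
  qed auto
  thus ?thesis using measure_nonneg[of \<mu> "- {0..1}"] by linarith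
qed

text \<open>\<open>ext_cyl e\<close> is a continuity set: its frontier lies in end points that are
  null by \<open>boundary_null\<close>. Replacing it by \<open>ccyl e\<close> in the limit is
  harmless as \<open>\<mu>\<close> lives on the unit interval.\<close>

lemma \<nu>_cyl_tendsto:
  assumes e: "e \<in> W t"
  shows "(\<lambda>i. measure (\<nu> i) (ext_cyl e)) \<longlonglongrightarrow> measure \<mu> (ccyl e)"
proof -
  interpret \<mu>: real_distribution \<mu> by (rule \<mu>)
  define L where "L = (if cyl_left e = 0 then {} else {cyl_left e})"
  define R where "R = (if cyl_right e = 1 then {} else {cyl_right e})"
  have "measure \<mu> L = 0"
    using cyl_left_boundary[OF e] boundary_null by (auto simp: L_def)
  moreover have "measure \<mu> R = 0"
    using cyl_right_boundary[OF e] boundary_null by (auto simp: R_def)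
  moreover have "measure \<mu> (frontier (ext_cyl e)) \<le> measure \<mu> (L \<union> R)"
    using frontier_ext_cyl[of e] unfolding L_def R_def by (intro \<mu>.finite_measure_mono) auto
  moreover have "measure \<mu> (L \<union> R) \<le> measure \<mu> L + measure \<mu> R"
    by (rule measure_Un_le) (auto simp: L_def R_def)
  ultimately have "measure \<mu> (frontier (ext_cyl e)) = 0"
    using measure_nonneg[of \<mu> "frontier (ext_cyl e)"] by linarith
  hence "emeasure \<mu> (frontier (ext_cyl e)) = 0" by (simp add: \<mu>.emeasure_eq_measure)
  hence "(\<lambda>i. measure (\<nu> i) (ext_cyl e)) \<longlonglongrightarrow> measure \<mu> (ext_cyl e)"
    by (intro weak_conv_imp_continuity_set_conv[OF \<nu>_real_distribution \<mu> \<nu>_conv ext_cyl_borel])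
  moreover have "measure \<mu> (ext_cyl e) = measure \<mu> (ccyl e)"
  proof -
    have "measure \<mu> (ext_cyl e) = measure \<mu> (ext_cyl e \<inter> {0..1}) + measure \<mu> (ext_cyl e - {0..1})"
      by (subst \<mu>.finite_measure_Union[symmetric]) (auto intro!: arg_cong[where f = "measure \<mu>"])
    moreover have "measure \<mu> (ext_cyl e - {0..1}) \<le> measure \<mu> (- {0..1})"
      by (intro \<mu>.finite_measure_mono) auto
    ultimately show ?thesis using \<mu>_off_unit measure_nonneg[of \<mu> "ext_cyl e - {0..1}"]
      by (simp add: ext_cyl_Int[OF e])
  qed
  ultimately show ?thesis by simp
qed

lemma filterlim_lev_div: "filterlim (\<lambda>i. lev i div d) at_top sequentially"
  unfolding filterlim_at_top
proof
  fix Z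
  show "eventually (\<lambda>i. Z \<le> lev i div d) sequentially"
    using eventually_ge_at_top[of "Z * d"]
  proof eventually_elim
    case (elim i)
    hence "Z * d \<le> lev i" using lev_ge[of i] by linarith
    thus ?case using d_pos by (simp add: less_eq_div_iff_mult_less_eq)
  qed
qed

text \<open>With \<open>m\<close> fixed only finitely many cylinder weights occur, and all converge;
  the error terms of order \<open>1 / (lev i div d)\<close> vanish.\<close>

lemma limit_entropy_lower_bound:
  assumes m: "m > 0"
  shows "(\<Sum>b<l. measure \<mu> (Iv p l n b) * ln (Lam p n b)) - real d * ln (real p) / 2
    \<le> part_entropy \<mu> (join_part (Tp p l n) (Iv p l n ` {..<l}) m) / real m"
proof -
  have inv: "(\<lambda>i. c / real (lev i div d)) \<longlonglongrightarrow> 0" for c :: real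
    by (rule filterlim_compose[OF lim_const_over_n filterlim_lev_div])
  have lower: "(\<lambda>i. (\<Sum>b<l. measure (\<nu> i) (ext_cyl [b]) * ln (Lam p n b))
      - (1 + 1 / real (lev i div d)) * (real d * ln (real p)) / 2)
    \<longlonglongrightarrow> (\<Sum>b<l. measure \<mu> (ccyl [b]) * ln (Lam p n b)) - (1 + 0) * (real d * ln (real p)) / 2"
    by (intro tendsto_diff tendsto_sum tendsto_mult tendsto_divide tendsto_add tendsto_const inv
      \<nu>_cyl_tendsto[of _ 1]) (auto simp: words_def)
  have upper: "(\<lambda>i. - (\<Sum>e\<in>W m. measure (\<nu> i) (ext_cyl e) * ln (measure (\<nu> i) (ext_cyl e))) / real m
      + real (l ^ m) / real (lev i div d))
    \<longlonglongrightarrow> - (\<Sum>e\<in>W m. measure \<mu> (ccyl e) * ln (measure \<mu> (ccyl e))) / real m + 0"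
    using m by (intro tendsto_add tendsto_divide tendsto_minus tendsto_sum tendsto_mult_ln_self
      tendsto_const inv \<nu>_cyl_tendsto[of _ m]) auto
  have "eventually (\<lambda>i. m \<le> lev i div d) sequentially"
    using filterlim_lev_div by (simp add: filterlim_at_top)
  hence "eventually (\<lambda>i. (\<Sum>b<l. measure (\<nu> i) (ext_cyl [b]) * ln (Lam p n b))
      - (1 + 1 / real (lev i div d)) * (real d * ln (real p)) / 2
    \<le> - (\<Sum>e\<in>W m. measure (\<nu> i) (ext_cyl e) * ln (measure (\<nu> i) (ext_cyl e))) / real m
      + real (l ^ m) / real (lev i div d)) sequentially"
  proof eventually_elim
    case (elim i)
    show ?case unfolding \<nu>_def
      by (rule quantized.semiclassical_entropy_bound[OF quantized_lev m elim])
  qed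
  from tendsto_le[OF _ upper lower this]
  have "(\<Sum>b<l. measure \<mu> (ccyl [b]) * ln (Lam p n b)) - real d * ln (real p) / 2
    \<le> part_entropy \<mu> (join_part (Tp p l n) (Iv p l n ` {..<l}) m) / real m"
    unfolding part_entropy_join_Iv by simp
  moreover have "(\<Sum>b<l. measure \<mu> (ccyl [b]) * ln (Lam p n b)) = (\<Sum>b<l. measure \<mu> (Iv p l n b) * ln (Lam p n b))"
    by (intro sum.cong) (auto simp: Iv_ccyl)
  ultimately show ?thesis by simp
qed

text \<open>The bound holds at every length \<open>Suc m\<close>, hence for the lower limit, and one
  partition suffices to bound a supremum from below.\<close>

lemma KS_entropy_lower_bound:
  "KS_entropy (Tp p l n) \<mu> \<ge> ereal ((\<Sum>b<l. measure \<mu> (Iv p l n b) * ln (Lam p n b)) - real d * ln (real p) / 2)"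
proof -
  have "ereal ((\<Sum>b<l. measure \<mu> (Iv p l n b) * ln (Lam p n b)) - real d * ln (real p) / 2)
    \<le> ent_part (Tp p l n) \<mu> (Iv p l n ` {..<l})"
    unfolding ent_part_def
    by (intro Liminf_bounded always_eventually allI) (simp add: limit_entropy_lower_bound del: of_nat_Suc)
  also have "\<dots> \<le> KS_entropy (Tp p l n) \<mu>"
    unfolding KS_entropy_def by (intro SUP_upper CollectI is_partition_Iv)
  finally show ?thesis .
qed

end

theorem theorem7:
  fixes p l :: nat and n :: "nat \<Rightarrow> nat"
    and U :: "nat \<Rightarrow> nat \<Rightarrow> nat \<Rightarrow> complex"
    and \<psi> :: "nat \<Rightarrow> nat \<Rightarrow> complex"
    and r :: "nat \<Rightarrow> nat" and \<mu> :: "real measure"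
  assumes "p \<ge> 2" and "l \<ge> 1" and "\<forall>j<l. n j \<ge> 1"
    and "(\<Sum>j<l. 1 / real p ^ n j) = 1"
    and "\<forall>k. quantization (Tp p l n) (p ^ k) (U k)"
    and "\<forall>k. normalized_eigenvector (p ^ k) (U k) (\<psi> k)"
    and "strict_mono r"
    and "real_distribution \<mu>"
    and "weak_conv_m (\<lambda>m. semiclassical_measure (p ^ r m) (\<psi> (r m))) \<mu>"
  shows "KS_entropy (Tp p l n) \<mu> \<ge>
    ereal ((\<Sum>j<l. measure \<mu> (Iv p l n j) * ln (Lam p n j))
           - 1/2 * ln (Max {Lam p n j | j. j < l}))"
proof -
  interpret semiclassical_limit p l n U \<psi> r \<mu>
  proof (intro semiclassical_limit.intro power_slopes.intro semiclassical_limit_axioms.intro)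
    show "1 \<le> n j" if "j < l" for j using assms(3) that by blast
    show "quantization (Tp p l n) (p ^ k) (U k)" for k using assms(5) by blast
    show "normalized_eigenvector (p ^ k) (U k) (\<psi> k)" for k using assms(6) by blast
  qed (fact assms)+
  show ?thesis using KS_entropy_lower_bound unfolding ln_Max_Lam by simp
qed

end
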